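(* Let $\phi:(\mathbb{P}^1)^3\dashrightarrow\mathbb{P}^3$ be a pyramidal trilinear rational map (with $Y_0,Y_1$ the quadric boundary surfaces). Then $\phi$ is birational of type $(1,1,2)$ if and only if the tensor $$W=\left(\frac{w_{ijk}}{\Delta_{ijk}}\right)_{0\le i,j,k\le 1}$$ has rank one.
   Context: Setting. $\mathbb{P}^n$ is complex projective $n$-space. $\phi:\mathbb{P}^1\times\mathbb{P}^1\times\mathbb{P}^1\dashrightarrow\mathbb{P}^3$ is the trilinear rational map given by $$\mathbf{f}=(f_0,f_1,f_2,f_3)=\sum_{0\le i,j,k\le 1} w_{ijk}\,\mathbf{P}_{ijk}\,s_it_ju_k,$$ with control points $\mathbf{P}_{ijk}=(1,x_{ijk},y_{ijk},z_{ijk})\in\mathbb{R}^4$ (identified with points of $\mathbb{P}^3$) and weights $w_{ijk}\in\mathbb{R}$. Boundary surfaces. $\Sigma_0$ (resp. $\Sigma_1$) is the closure of the image of $\phi$ restricted to $(s_0:s_1)=(1:0)$ (resp. $(0:1)$). $T_0,T_1$ and $Y_0,Y_1$ are defined in the same way using $(t_0:t_1)$ and $(u_0:u_1)$. So $\mathbf{P}_{ijk}\in\Sigma_i\cap T_j\cap Y_k$. Boundary lines: $s_{jk}$ joins $\mathbf{P}_{0jk},\mathbf{P}_{1jk}$; $t_{ik}$ joins $\mathbf{P}_{i0k},\mathbf{P}_{i1k}$; $u_{ij}$ joins $\mathbf{P}_{ij0},\mathbf{P}_{ij1}$ (images of the corresponding coordinate lines). Each boundary surface is a plane or a quadric. Standing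 nondegeneracy assumption: the surfaces $\Sigma_i,T_j,Y_k$ are smooth surfaces, pairwise distinct, and $s_{jk},t_{ik},u_{ij}$ are lines, pairwise distinct. $\phi$ is pyramidal if for one of the three parameters (1) the four boundary lines intersect at a point, and (2) the two boundary surfaces are quadrics. Convention: this parameter is $u$, so the $u_{ij}$ meet at a point $\mathbf{A}$, $Y_0,Y_1$ are quadrics, and $\Sigma_i,T_j$ are planes. Let $s=\Sigma_0\cap\Sigma_1$, $t=T_0\cap T_1$, and let $\Pi_0$ be the plane through $s$ and $t$, defined by $\boldsymbol{\pi}_0\cdot\mathbf{x}^T=0$ with $\boldsymbol{\pi}_0\in\mathbb{R}^4$. Set $\Delta_{ijk}=1/\langle\boldsymbol{\pi}_0,\mathbf{P}_{ijk}\rangle$ (well defined under the standing assumption), where $\langle\cdot,\cdot\rangle$ is the usual scalar product. Type. If $\phi$ is birational, its inverse is $\mathbf{x}\mapsto(A_0:A_1)\times(B_0:B_1)\times(C_0:C_1)$ with $A_0,A_1$ (resp. $B_0,B_1$; $C_0,C_1$) homogeneous of the same degree in $\mathbf{x}=(x_0,\dots,x_3)$ without common factor; the type of $\phi$ is $(\deg A_i,\deg B_j,\deg C_k)$. A tensor has rank one if it equals $\boldsymbol{\alpha}\otimes\boldsymbol{\beta}\otimes\boldsymbol{\gamma}$ with nonzero vectors. *)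

theory Defs
  imports
    "HOL-Analysis.Analysis"
    "HOL-Library.Poly_Mapping"
    "HOL-Computational_Algebra.Factorial_Ring"
begin

text \<open>
  A point of complex projective space is given by a nonzero vector of homogeneous coordinates:
  \<open>complex^2\<close> for the projective line, \<open>complex^4\<close> for projective 3-space. A subset of projective
  3-space is represented by the set of all its homogeneous coordinate vectors. Coordinates are
  numbered \<open>0, 1\<close> and \<open>0, 1, 2, 3\<close> in the index types \<open>2\<close> and \<open>4\<close> (where \<open>2 = 0\<close>
  and \<open>4 = 0\<close>, respectively).
\<close>

definition same_point :: "complex^'n \<Rightarrow> complex^'n \<Rightarrow> bool" where
  "same_point x y \<longleftrightarrow> x \<noteq> 0 \<and> y \<noteq> 0 \<and> (\<exists>c. c \<noteq> 0 \<and> y = c *s x)"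

definition cvec :: "real^'n \<Rightarrow> complex^'n" where
  "cvec v = (\<chi> l. complex_of_real (v $ l))"


subsection \<open>Polynomials in \<open>x\<^sub>0, x\<^sub>1, x\<^sub>2, x\<^sub>3\<close> over the complex numbers\<close>

text \<open>A polynomial maps exponent vectors to coefficients.\<close>

type_synonym poly4 = "(4 \<Rightarrow>\<^sub>0 nat) \<Rightarrow>\<^sub>0 complex"

definition eval4 :: "poly4 \<Rightarrow> complex^4 \<Rightarrow> complex" where
  "eval4 F x = (\<Sum>m\<in>Poly_Mapping.keys F. Poly_Mapping.lookup F m * (\<Prod>l\<in>UNIV. (x $ l) ^ Poly_Mapping.lookup m l))"

definition homogeneous4 :: "nat \<Rightarrow> poly4 \<Rightarrow> bool" where
  "homogeneous4 d F \<longleftrightarrow> (\<forall>m\<in>Poly_Mapping.keys F. (\<Sum>l\<in>UNIV. Poly_Mapping.lookup m l) = d)"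

definition partial4 :: "4 \<Rightarrow> poly4 \<Rightarrow> poly4" where
  "partial4 l F = (\<Sum>m\<in>Poly_Mapping.keys F.
     Poly_Mapping.single (m - Poly_Mapping.single l 1)
       (of_nat (Poly_Mapping.lookup m l) * Poly_Mapping.lookup F m))"

definition no_common_factor :: "poly4 \<Rightarrow> poly4 \<Rightarrow> bool" where
  "no_common_factor F G \<longleftrightarrow> (\<forall>H. H dvd F \<longrightarrow> H dvd G \<longrightarrow> H dvd 1)"


subsection \<open>Lines and surfaces in projective 3-space\<close>

definition zero_locus :: "poly4 \<Rightarrow> (complex^4) set" where
  "zero_locus F = {x. x \<noteq> 0 \<and> eval4 F x = 0}"

definition zariski_closure :: "(complex^4) set \<Rightarrow> (complex^4) set" where
  "zariski_closure S =
     {x. x \<noteq> 0 \<and> (\<forall>d F. homogeneous4 d F \<longrightarrow> (\<forall>y\<in>S. eval4 F y = 0) \<longrightarrow> eval4 F x = 0)}"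

definition smooth_surface :: "(complex^4) set \<Rightarrow> bool" where
  "smooth_surface X \<longleftrightarrow>
     (\<exists>d F. homogeneous4 d F \<and> irreducible F \<and> X = zero_locus F \<and>
            (\<forall>x\<in>X. \<exists>l. eval4 (partial4 l F) x \<noteq> 0))"

definition quadric :: "(complex^4) set \<Rightarrow> bool" where
  "quadric X \<longleftrightarrow> (\<exists>F. homogeneous4 2 F \<and> irreducible F \<and> X = zero_locus F)"

definition real_plane :: "real^4 \<Rightarrow> (complex^4) set" where
  "real_plane \<pi> = {x. x \<noteq> 0 \<and> (\<Sum>l\<in>UNIV. complex_of_real (\<pi> $ l) * x $ l) = 0}"

definition join :: "complex^4 \<Rightarrow> complex^4 \<Rightarrow> (complex^4) set" where
  "join p q = {x. x \<noteq> 0 \<and> (\<exists>a b. x = a *s p + b *s q)}"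

definition is_line :: "(complex^4) set \<Rightarrow> bool" where
  "is_line L \<longleftrightarrow> (\<exists>p q. p \<noteq> 0 \<and> q \<noteq> 0 \<and> \<not> same_point p q \<and> L = join p q)"


subsection \<open>The trilinear map and its boundary\<close>

text \<open>
  Below, \<open>w i j k\<close> are the weights and \<open>P i j k\<close> the control points, \<open>i, j, k\<close> ranging over the
  two elements \<open>0, 1\<close> of the index type \<open>2\<close>.
\<close>

type_synonym weights = "2 \<Rightarrow> 2 \<Rightarrow> 2 \<Rightarrow> real"
type_synonym control_points = "2 \<Rightarrow> 2 \<Rightarrow> 2 \<Rightarrow> real^4"

definition trilinear_map ::
  "weights \<Rightarrow> control_points \<Rightarrow> complex^2 \<Rightarrow> complex^2 \<Rightarrow> complex^2 \<Rightarrow> complex^4" where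
  "trilinear_map w P s t u =
     (\<Sum>i\<in>UNIV. \<Sum>j\<in>UNIV. \<Sum>k\<in>UNIV.
        (complex_of_real (w i j k) * s $ i * t $ j * u $ k) *s cvec (P i j k))"

text \<open>The point \<open>(1:0)\<close> (resp. \<open>(0:1)\<close>) of the projective line is \<open>axis 0 1\<close> (resp. \<open>axis 1 1\<close>).
  The map is undefined where all four coordinates vanish.\<close>

definition \<Sigma>_surface :: "weights \<Rightarrow> control_points \<Rightarrow> 2 \<Rightarrow> (complex^4) set" where
  "\<Sigma>_surface w P i = zariski_closure
     {x. x \<noteq> 0 \<and> (\<exists>t u. t \<noteq> 0 \<and> u \<noteq> 0 \<and> x = trilinear_map w P (axis i 1) t u)}"

definition T_surface :: "weights \<Rightarrow> control_points \<Rightarrow> 2 \<Rightarrow> (complex^4) set" where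
  "T_surface w P j = zariski_closure
     {x. x \<noteq> 0 \<and> (\<exists>s u. s \<noteq> 0 \<and> u \<noteq> 0 \<and> x = trilinear_map w P s (axis j 1) u)}"

definition Y_surface :: "weights \<Rightarrow> control_points \<Rightarrow> 2 \<Rightarrow> (complex^4) set" where
  "Y_surface w P k = zariski_closure
     {x. x \<noteq> 0 \<and> (\<exists>s t. s \<noteq> 0 \<and> t \<noteq> 0 \<and> x = trilinear_map w P s t (axis k 1))}"

definition s_line :: "control_points \<Rightarrow> 2 \<Rightarrow> 2 \<Rightarrow> (complex^4) set" where
  "s_line P j k = join (cvec (P 0 j k)) (cvec (P 1 j k))"

definition t_line :: "control_points \<Rightarrow> 2 \<Rightarrow> 2 \<Rightarrow> (complex^4) set" where
  "t_line P i k = join (cvec (P i 0 k)) (cvec (P i 1 k))"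

definition u_line :: "control_points \<Rightarrow> 2 \<Rightarrow> 2 \<Rightarrow> (complex^4) set" where
  "u_line P i j = join (cvec (P i j 0)) (cvec (P i j 1))"

definition nondegenerate :: "weights \<Rightarrow> control_points \<Rightarrow> bool" where
  "nondegenerate w P \<longleftrightarrow>
     (let surfaces = [\<Sigma>_surface w P 0, \<Sigma>_surface w P 1, T_surface w P 0, T_surface w P 1,
                      Y_surface w P 0, Y_surface w P 1];
          lines = [s_line P 0 0, s_line P 0 1, s_line P 1 0, s_line P 1 1,
                   t_line P 0 0, t_line P 0 1, t_line P 1 0, t_line P 1 1,
                   u_line P 0 0, u_line P 0 1, u_line P 1 0, u_line P 1 1]
      in (\<forall>X\<in>set surfaces. smooth_surface X) \<and> distinct surfaces \<and>
         (\<forall>L\<in>set lines. is_line L) \<and> distinct lines)"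

text \<open>Pyramidal with respect to the parameter \<open>u\<close>. That \<open>\<Sigma>\<^sub>i\<close> and \<open>T\<^sub>j\<close> are then planes, and that
  the weights are nonzero, are consequences (together with nondegeneracy).\<close>

definition pyramidal_u :: "weights \<Rightarrow> control_points \<Rightarrow> bool" where
  "pyramidal_u w P \<longleftrightarrow>
     (\<exists>A. \<forall>i j. A \<in> u_line P i j) \<and> (\<forall>k. quadric (Y_surface w P k))"


subsection \<open>Birationality and type\<close>

text \<open>
  \<open>A 0, A 1\<close> stand for \<open>A\<^sub>0, A\<^sub>1\<close>, and \<open>pair_map A x\<close> is the vector \<open>(A\<^sub>0(x), A\<^sub>1(x))\<close>. Two rational
  maps between irreducible varieties are equal if they agree on a nonempty open set, equivalently
  wherever both are defined. So \<open>inverse_map\<close> says that each of the two composites of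
  \<open>\<phi>\<close> and \<open>x \<mapsto> (A\<^sub>0:A\<^sub>1) \<times> (B\<^sub>0:B\<^sub>1) \<times> (C\<^sub>0:C\<^sub>1)\<close> is defined somewhere, and is the identity
  wherever it is defined (on an open, hence dense, set).
\<close>

definition pair_map :: "(2 \<Rightarrow> poly4) \<Rightarrow> complex^4 \<Rightarrow> complex^2" where
  "pair_map A x = (\<chi> i. eval4 (A i) x)"

definition inverse_map ::
  "(complex^2 \<Rightarrow> complex^2 \<Rightarrow> complex^2 \<Rightarrow> complex^4) \<Rightarrow>
   (2 \<Rightarrow> poly4) \<Rightarrow> (2 \<Rightarrow> poly4) \<Rightarrow> (2 \<Rightarrow> poly4) \<Rightarrow> bool" where
  "inverse_map f A B C \<longleftrightarrow>
     (let dom_inv = {x. x \<noteq> 0 \<and> pair_map A x \<noteq> 0 \<and> pair_map B x \<noteq> 0 \<and> pair_map C x \<noteq> 0};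
          dom_inv_f = {(s, t, u). s \<noteq> 0 \<and> t \<noteq> 0 \<and> u \<noteq> 0 \<and> f s t u \<in> dom_inv};
          dom_f_inv = {x \<in> dom_inv. f (pair_map A x) (pair_map B x) (pair_map C x) \<noteq> 0}
      in dom_inv_f \<noteq> {} \<and>
         (\<forall>(s, t, u) \<in> dom_inv_f.
            same_point s (pair_map A (f s t u)) \<and>
            same_point t (pair_map B (f s t u)) \<and>
            same_point u (pair_map C (f s t u))) \<and>
         dom_f_inv \<noteq> {} \<and>
         (\<forall>x \<in> dom_f_inv. same_point x (f (pair_map A x) (pair_map B x) (pair_map C x))))"

definition birational_of_type ::
  "(complex^2 \<Rightarrow> complex^2 \<Rightarrow> complex^2 \<Rightarrow> complex^4) \<Rightarrow> nat \<times> nat \<times> nat \<Rightarrow> bool" where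
  "birational_of_type f = (\<lambda>(a, b, c). \<exists>A B C.
     (\<forall>i. homogeneous4 a (A i)) \<and> no_common_factor (A 0) (A 1) \<and>
     (\<forall>j. homogeneous4 b (B j)) \<and> no_common_factor (B 0) (B 1) \<and>
     (\<forall>k. homogeneous4 c (C k)) \<and> no_common_factor (C 0) (C 1) \<and>
     inverse_map f A B C)"


subsection \<open>The weight tensor\<close>

definition \<Delta> :: "real^4 \<Rightarrow> control_points \<Rightarrow> 2 \<Rightarrow> 2 \<Rightarrow> 2 \<Rightarrow> real" where
  "\<Delta> \<pi> P i j k = 1 / (\<pi> \<bullet> P i j k)"

definition rank_one :: "(2 \<Rightarrow> 2 \<Rightarrow> 2 \<Rightarrow> real) \<Rightarrow> bool" where
  "rank_one W \<longleftrightarrow>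
     (\<exists>\<alpha> \<beta> \<gamma> :: real^2. \<alpha> \<noteq> 0 \<and> \<beta> \<noteq> 0 \<and> \<gamma> \<noteq> 0 \<and> (\<forall>i j k. W i j k = \<alpha> $ i * \<beta> $ j * \<gamma> $ k))"

end

theory Submission
  imports Defs "HOL-Computational_Algebra.Fundamental_Theorem_Algebra"
begin

text \<open>
  Since \<open>Y\<^sub>0, Y\<^sub>1\<close> are quadrics, no plane contains them, so all weights are nonzero and the
  control points on each of them span the space. The common point of the \<open>u\<^sub>i\<^sub>j\<close> makes \<open>\<Sigma>\<^sub>i\<close> and
  \<open>T\<^sub>j\<close> planes \<open>\<sigma>\<^sub>i = 0\<close> and \<open>\<tau>\<^sub>j = 0\<close>, and these forms can be scaled such that
  \<open>\<sigma>\<^sub>0 + \<sigma>\<^sub>1 = \<pi>\<^sub>0 = \<tau>\<^sub>0 + \<tau>\<^sub>1\<close>. Then the value of \<open>\<sigma>\<^sub>1\<^sub>-\<^sub>i\<close> at \<open>f(s, t, u)\<close> is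
  \<open>s\<^sub>i \<Sum>\<^sub>j\<^sub>k W\<^sub>i\<^sub>j\<^sub>k t\<^sub>j u\<^sub>k\<close>, and similarly for \<open>\<tau>\<close>. If the inverse is linear in \<open>s\<close>, then its
  components vanish on \<open>\<Sigma>\<^sub>0\<close> and \<open>\<Sigma>\<^sub>1\<close>, so they are multiples of \<open>\<sigma>\<^sub>0, \<sigma>\<^sub>1\<close>, which forces the two
  slices of \<open>W\<close> to be proportional; likewise for \<open>t\<close>. Conversely, if \<open>W = \<alpha> \<otimes> \<beta> \<otimes> \<gamma>\<close>, then multiples
  of \<open>\<sigma>\<^sub>1, \<sigma>\<^sub>0\<close> and \<open>\<tau>\<^sub>1, \<tau>\<^sub>0\<close> recover \<open>s\<close> and \<open>t\<close>, and solving the remaining coordinate, which is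
  linear in \<open>u\<close>, gives the equations of the two quadrics.
\<close>

subsection \<open>Evaluation of polynomials\<close>


lemma poly_mapping_sum_single:
  "(\<Sum>m\<in>Poly_Mapping.keys F. Poly_Mapping.single m (Poly_Mapping.lookup F m)) = F"
  by (rule poly_mapping_eqI)
     (auto simp: lookup_sum lookup_single when_def in_keys_iff)

lemma poly_mapping_single_induct [case_names zero add single]:
  fixes F :: "'a \<Rightarrow>\<^sub>0 'b::comm_monoid_add"
  assumes "P 0" and "\<And>F G. P F \<Longrightarrow> P G \<Longrightarrow> P (F + G)"
    and "\<And>m c. P (Poly_Mapping.single m c)"
  shows "P F"
proof -
  have "P (\<Sum>m\<in>S. Poly_Mapping.single m (Poly_Mapping.lookup F m))" if "finite S" for S
    using that by (induction S rule: finite_induct) (auto intro: assms)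
  from this[OF finite_keys[of F]] show ?thesis by (simp add: poly_mapping_sum_single)
qed

definition mon4 :: "(4 \<Rightarrow>\<^sub>0 nat) \<Rightarrow> complex^4 \<Rightarrow> complex" where
  "mon4 m x = (\<Prod>l\<in>UNIV. (x $ l) ^ Poly_Mapping.lookup m l)"

lemma eval4_mon4:
  "eval4 F x = (\<Sum>m\<in>Poly_Mapping.keys F. Poly_Mapping.lookup F m * mon4 m x)"
  by (simp add: eval4_def mon4_def)

lemma mon4_zero [simp]: "mon4 0 x = 1"
  by (simp add: mon4_def)

lemma mon4_add: "mon4 (m + n) x = mon4 m x * mon4 n x"
  by (simp add: mon4_def lookup_add power_add prod.distrib)

lemma keys_sum_single:
  assumes "g m 0 = 0"
  shows "(\<Sum>k\<in>Poly_Mapping.keys (Poly_Mapping.single m c).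
           g k (Poly_Mapping.lookup (Poly_Mapping.single m c) k)) = g m c"
  using assms by (cases "c = 0") simp_all

text \<open>A sum over terms that is additive in the coefficient is additive in the polynomial, so
  multiplicativity need only be checked on single terms. Evaluation and sorting by degree are both
  instances.\<close>

lemma keys_sum_mult:
  fixes g :: "'m::comm_monoid_add \<Rightarrow> 'a::comm_semiring_1 \<Rightarrow> 'c::comm_semiring_1"
  defines "h \<equiv> \<lambda>F. \<Sum>k\<in>Poly_Mapping.keys F. g k (Poly_Mapping.lookup F k)"
  assumes zero: "\<And>m. g m 0 = 0" and add: "\<And>m a b. g m (a + b) = g m a + g m b"
    and mult: "\<And>m n a b. g (m + n) (a * b) = g m a * g n b"
  shows "h (F * G) = h F * h G"
proof -
  have single: "h (Poly_Mapping.single m c) = g m c" for m c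
    unfolding h_def by (rule keys_sum_single) (rule zero)
  have plus: "h (F + G) = h F + h G" for F G
    unfolding h_def by (rule setsum_keys_plus_distrib) (simp_all add: zero add)
  have [simp]: "h 0 = 0" by (simp add: h_def)
  show ?thesis
  proof (induction F rule: poly_mapping_single_induct)
    case (single m c)
    show ?case
      by (induction G rule: poly_mapping_single_induct)
         (simp_all add: mult_single \<open>\<And>m c. h (Poly_Mapping.single m c) = g m c\<close> mult plus distrib_left)
  qed (simp_all add: plus distrib_right)
qed

lemma eval4_zero [simp]: "eval4 0 x = 0"
  by (simp add: eval4_def)

lemma eval4_single: "eval4 (Poly_Mapping.single m c) x = c * mon4 m x"
  unfolding eval4_mon4 by (rule keys_sum_single[of "\<lambda>k a. a * mon4 k x"]) simp

lemma eval4_one [simp]: "eval4 1 x = 1"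
  using eval4_single[of 0 1 x] by simp

lemma eval4_add [simp]: "eval4 (F + G) x = eval4 F x + eval4 G x"
  unfolding eval4_mon4
  by (rule setsum_keys_plus_distrib) (simp_all add: distrib_right)

lemma eval4_mult [simp]: "eval4 (F * G) x = eval4 F x * eval4 G x"
  unfolding eval4_mon4
  by (rule keys_sum_mult[of "\<lambda>k a. a * mon4 k x"]) (simp_all add: distrib_right mon4_add)

lemma eval4_uminus [simp]: "eval4 (- F) x = - eval4 F x"
  using eval4_add[of F "-F" x] by (simp add: add_eq_0_iff2 del: eval4_add)

lemma eval4_diff [simp]: "eval4 (F - G) x = eval4 F x - eval4 G x"
  using eval4_add[of F "-G" x] by simp

lemma eval4_sum [simp]: "eval4 (\<Sum>i\<in>S. F i) x = (\<Sum>i\<in>S. eval4 (F i) x)"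
  by (induction S rule: infinite_finite_induct) simp_all

lemma eval4_prod [simp]: "eval4 (\<Prod>i\<in>S. F i) x = (\<Prod>i\<in>S. eval4 (F i) x)"
  by (induction S rule: infinite_finite_induct) simp_all

lemma eval4_power [simp]: "eval4 (F ^ n) x = eval4 F x ^ n"
  by (induction n) simp_all

definition const4 :: "complex \<Rightarrow> poly4" where "const4 c = Poly_Mapping.single 0 c"

lemma eval4_const4 [simp]: "eval4 (const4 c) x = c"
  by (simp add: const4_def eval4_single)

text \<open>The substitution \<open>x\<^sub>l = T ^ (N ^ l)\<close> sends distinct monomials of degree less than
  \<open>N\<close> in each variable to distinct powers of \<open>T\<close>.\<close>

lemma digits4_inject:
  fixes N :: nat
  assumes "a0 < N" "a1 < N" "a2 < N" "b0 < N" "b1 < N" "b2 < N"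
    and eq: "a0 + N * (a1 + N * (a2 + N * a3)) = b0 + N * (b1 + N * (b2 + N * b3))"
  shows "a0 = b0 \<and> a1 = b1 \<and> a2 = b2 \<and> a3 = b3"
proof -
  have *: "a = b \<and> c = d" if "a + N * c = b + N * d" "a < N" "b < N" for a b c d
    using arg_cong[OF that(1), of "\<lambda>x. x mod N"] arg_cong[OF that(1), of "\<lambda>x. x div N"] that(2,3)
    by simp
  show ?thesis using *[OF eq] * assms by metis
qed

text \<open>The substitution turns \<open>F\<close> into a univariate \<open>p\<close> with the same
  coefficients at the exponents \<open>e m\<close>. As \<open>p\<close> vanishes everywhere, it is
  the zero polynomial.\<close>

lemma eval4_eq_zeroD:
  assumes "\<And>x. eval4 F x = 0"
  shows "F = 0"
proof (rule ccontr)
  assume "F \<noteq> 0"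
  define N where "N = Suc (\<Sum>m\<in>Poly_Mapping.keys F. \<Sum>l\<in>UNIV. Poly_Mapping.lookup m l)"
  define e where "e m = Poly_Mapping.lookup m 1 + N * (Poly_Mapping.lookup m 2 + N * (Poly_Mapping.lookup m 3 + N * Poly_Mapping.lookup m 4))"
    for m :: "4 \<Rightarrow>\<^sub>0 nat"
  have lt: "Poly_Mapping.lookup m l < N" if "m \<in> Poly_Mapping.keys F" for m l
  proof -
    have "Poly_Mapping.lookup m l \<le> (\<Sum>l\<in>UNIV. Poly_Mapping.lookup m l)"
      by (rule member_le_sum) auto
    also have "\<dots> \<le> (\<Sum>m\<in>Poly_Mapping.keys F. \<Sum>l\<in>UNIV. Poly_Mapping.lookup m l)"
      using that by (intro member_le_sum[of m _ "\<lambda>m. \<Sum>l\<in>UNIV. Poly_Mapping.lookup m l"]) auto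
    finally show ?thesis by (simp add: N_def)
  qed
  have inj: "inj_on e (Poly_Mapping.keys F)"
  proof (rule inj_onI)
    fix m n assume "m \<in> Poly_Mapping.keys F" "n \<in> Poly_Mapping.keys F" "e m = e n"
    then have "\<forall>l. Poly_Mapping.lookup m l = Poly_Mapping.lookup n l"
      unfolding forall_4 e_def by (intro digits4_inject[of _ N]) (auto intro: lt)
    then show "m = n" by (auto intro: poly_mapping_eqI)
  qed
  define p where "p = (\<Sum>m\<in>Poly_Mapping.keys F. monom (Poly_Mapping.lookup F m) (e m))"
  have "poly p T = 0" for T
  proof -
    define x :: "complex^4" where
      "x = (\<chi> l. if l = 1 then T else if l = 2 then T ^ N else if l = 3 then T ^ (N * N) else T ^ (N * (N * N)))"
    have "x $ 1 = T" by (simp add: x_def)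
    moreover have "x $ 2 = T ^ N" by (simp add: x_def)
    moreover have "x $ 3 = T ^ (N * N)" by (simp add: x_def)
    moreover have "x $ 4 = T ^ (N * (N * N))" by (simp add: x_def)
    ultimately have "mon4 m x = T ^ e m" for m
      unfolding mon4_def e_def UNIV_4 power_add distrib_left power_mult by (simp add: power_mult)
    then have "poly p T = eval4 F x"
      by (simp add: p_def poly_sum poly_monom eval4_mon4)
    then show ?thesis using assms by simp
  qed
  then have "p = 0" using poly_all_0_iff_0 by blast
  from \<open>F \<noteq> 0\<close> obtain m where m: "m \<in> Poly_Mapping.keys F"
    by (metis lookup_not_eq_zero_eq_in_keys lookup_zero poly_mapping_eqI)
  have "coeff p (e m) = (\<Sum>n\<in>Poly_Mapping.keys F. if n = m then Poly_Mapping.lookup F n else 0)"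
    unfolding p_def coeff_sum coeff_monom
    by (intro sum.cong) (use m inj in \<open>auto simp: inj_on_def\<close>)
  also have "\<dots> = Poly_Mapping.lookup F m" using m by (simp add: sum.delta)
  finally show False using m \<open>p = 0\<close> by (simp add: in_keys_iff)
qed

lemma eval4_inject:
  assumes "\<And>x. eval4 F x = eval4 G x"
  shows "F = G"
  using eval4_eq_zeroD[of "F - G"] assms by simp

text \<open>Degree and order at 0 are both additive and agree on a monomial. Since the order never
  exceeds the degree, they agree on each factor, which leaves a single term.\<close>

lemma monom_factor:
  fixes p q :: "'a::idom poly"
  assumes pq: "p * q = monom a d" and "a \<noteq> 0"
  shows "\<exists>b c e. e \<le> d \<and> p = monom b e \<and> q = monom c (d - e)"
proof -
  have nz: "p \<noteq> 0" "q \<noteq> 0" "p * q \<noteq> 0" using assms by auto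
  have order_monom: "order 0 (monom a d) = d"
    using \<open>a \<noteq> 0\<close> by (metis order_0_monom)
  have eq: "degree p + degree q = d" "order 0 p + order 0 q = d"
    using degree_mult_eq[OF nz(1,2)] order_mult[OF nz(3), of 0] \<open>a \<noteq> 0\<close>
    unfolding pq order_monom by (simp_all add: degree_monom_eq)
  have le: "order 0 p \<le> degree p" "order 0 q \<le> degree q"
    using nz by (simp_all add: order_degree)
  have *: "\<exists>b. r = monom b (degree r)" if "order 0 r = degree r" "r \<noteq> 0" for r :: "'a poly"
  proof -
    have "monom 1 (degree r) dvd r" using order_1[of 0 r] that by (simp add: monom_altdef)
    then obtain s where s: "r = monom 1 (degree r) * s" by (elim dvdE)
    have "s \<noteq> 0" using s that by auto
    then have "degree s = 0"
      using degree_mult_eq[of "monom 1 (degree r)" s] s that by (simp add: degree_monom_eq)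
    then obtain b where "s = [:b:]" by (metis degree_0_id)
    with s have "r = monom b (degree r)" by (simp add: mult.commute smult_monom)
    then show ?thesis ..
  qed
  have "order 0 p = degree p" "order 0 q = degree q" using eq le by auto
  with * nz obtain b c where "p = monom b (degree p)" "q = monom c (degree q)" by metis
  with eq show ?thesis by (metis le_add1 add_diff_cancel_left')
qed

subsection \<open>Linear forms and homogeneous polynomials\<close>

definition lf :: "complex^'n \<Rightarrow> complex^'n \<Rightarrow> complex" where
  "lf c x = (\<Sum>l\<in>UNIV. c $ l * x $ l)"

lemma lf_0_left [simp]: "lf 0 x = 0" and lf_0_right [simp]: "lf c 0 = 0"
  and lf_add_left [simp]: "lf (c + d) x = lf c x + lf d x"
  and lf_add_right [simp]: "lf c (x + y) = lf c x + lf c y"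
  and lf_diff_left [simp]: "lf (c - d) x = lf c x - lf d x"
  and lf_diff_right [simp]: "lf c (x - y) = lf c x - lf c y"
  and lf_scale_left [simp]: "lf (a *s c) x = a * lf c x"
  and lf_scale_right [simp]: "lf c (a *s x) = a * lf c x"
  by (simp_all add: lf_def sum.distrib sum_subtractf sum_distrib_left algebra_simps)

lemma lf_sum_right [simp]: "lf c (\<Sum>i\<in>S. f i) = (\<Sum>i\<in>S. lf c (f i))"
  by (induction S rule: infinite_finite_induct) simp_all

lemma lf_axis_right [simp]: "lf c (axis l a) = c $ l * a"
  by (simp add: lf_def axis_def if_distrib cong: if_cong)

lemma lf_eq_0_iff: "(\<forall>x. lf c x = 0) \<longleftrightarrow> c = 0"
proof
  assume "\<forall>x. lf c x = 0"
  then have "lf c (axis l 1) = 0" for l by blast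
  then show "c = 0" by (simp add: vec_eq_iff)
qed simp

definition var4 :: "4 \<Rightarrow> poly4" where
  "var4 l = Poly_Mapping.single (Poly_Mapping.single l 1) 1"

definition lin4 :: "complex^4 \<Rightarrow> poly4" where
  "lin4 c = (\<Sum>l\<in>UNIV. Poly_Mapping.single (Poly_Mapping.single l 1) (c $ l))"

lemma mon4_single: "mon4 (Poly_Mapping.single l n) x = (x $ l) ^ n"
proof -
  have "mon4 (Poly_Mapping.single l n) x = (\<Prod>i\<in>UNIV. if i = l then (x $ l) ^ n else 1)"
    unfolding mon4_def by (intro prod.cong) (auto simp: lookup_single when_def)
  then show ?thesis by (simp add: prod.delta)
qed

lemma eval4_var4 [simp]: "eval4 (var4 l) x = x $ l"
  by (simp add: var4_def eval4_single mon4_single)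

lemma eval4_lin4 [simp]: "eval4 (lin4 c) x = lf c x"
  by (simp add: lin4_def eval4_single mon4_single lf_def)

abbreviation deg4 :: "(4 \<Rightarrow>\<^sub>0 nat) \<Rightarrow> nat" where
  "deg4 m \<equiv> \<Sum>l\<in>UNIV. Poly_Mapping.lookup m l"

lemma deg4_single [simp]: "deg4 (Poly_Mapping.single l n) = n"
  by (simp add: lookup_single when_def)

lemma homogeneous4_single:
  "deg4 m = d \<Longrightarrow> homogeneous4 d (Poly_Mapping.single m c)"
  by (cases "c = 0") (auto simp: homogeneous4_def)

lemma homogeneous4_add: "homogeneous4 d F \<Longrightarrow> homogeneous4 d G \<Longrightarrow> homogeneous4 d (F + G)"
  unfolding homogeneous4_def using Poly_Mapping.keys_add[of F G] by blast

lemma homogeneous4_uminus: "homogeneous4 d F \<Longrightarrow> homogeneous4 d (- F)"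
  by (simp add: homogeneous4_def)

lemma homogeneous4_diff: "homogeneous4 d F \<Longrightarrow> homogeneous4 d G \<Longrightarrow> homogeneous4 d (F - G)"
  using homogeneous4_add[OF _ homogeneous4_uminus, of d F G] by simp

lemma homogeneous4_sum: "(\<And>i. i \<in> S \<Longrightarrow> homogeneous4 d (F i)) \<Longrightarrow> homogeneous4 d (\<Sum>i\<in>S. F i)"
  by (induction S rule: infinite_finite_induct)
     (auto intro!: homogeneous4_add, auto simp: homogeneous4_def)

lemma homogeneous4_mult:
  assumes "homogeneous4 d F" "homogeneous4 e G"
  shows "homogeneous4 (d + e) (F * G)"
  unfolding homogeneous4_def
proof
  fix m assume "m \<in> Poly_Mapping.keys (F * G)"
  then obtain a b where "m = a + b" "a \<in> Poly_Mapping.keys F" "b \<in> Poly_Mapping.keys G"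
    using Poly_Mapping.keys_mult[of F G] by blast
  then show "deg4 m = d + e"
    using assms by (simp add: homogeneous4_def lookup_add sum.distrib)
qed

lemma homogeneous4_lin4: "homogeneous4 1 (lin4 c)"
  unfolding lin4_def by (intro homogeneous4_sum homogeneous4_single deg4_single)

lemma homogeneous4_const4: "homogeneous4 0 (const4 c)"
  unfolding const4_def by (intro homogeneous4_single) simp

lemma homogeneous4_0_imp_const4:
  assumes "homogeneous4 0 F"
  shows "\<exists>c. F = const4 c"
proof
  have "m = 0" if "m \<in> Poly_Mapping.keys F" for m
    using assms that by (auto simp: homogeneous4_def intro!: poly_mapping_eqI)
  then show "F = const4 (Poly_Mapping.lookup F 0)"
    by (intro poly_mapping_eqI) (auto simp: const4_def lookup_single when_def in_keys_iff)
qed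

lemma homogeneous4_1_imp_lin4:
  assumes "homogeneous4 1 F"
  shows "\<exists>c. F = lin4 c"
proof
  let ?c = "(\<chi> l. Poly_Mapping.lookup F (Poly_Mapping.single l 1)) :: complex^4"
  have key: "\<exists>l. m = Poly_Mapping.single l 1" if "m \<in> Poly_Mapping.keys F" for m
  proof -
    have one: "deg4 m = 1" using assms that by (auto simp: homogeneous4_def)
    then obtain l where l: "Poly_Mapping.lookup m l \<noteq> 0" by (metis sum.neutral zero_neq_one)
    have "deg4 m = Poly_Mapping.lookup m l + (\<Sum>i\<in>UNIV - {l}. Poly_Mapping.lookup m i)"
      by (simp add: sum.remove)
    then have "Poly_Mapping.lookup m l = 1" "(\<Sum>i\<in>UNIV - {l}. Poly_Mapping.lookup m i) = 0"
      using one l by linarith+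
    then have "Poly_Mapping.lookup m i = (if i = l then 1 else 0)" for i
      by (cases "i = l") (auto simp: sum_eq_0_iff)
    then have "m = Poly_Mapping.single l 1"
      by (intro poly_mapping_eqI) (simp add: lookup_single when_def)
    then show ?thesis ..
  qed
  have inj: "Poly_Mapping.single l (1::nat) = Poly_Mapping.single l' 1 \<longleftrightarrow> l = l'" for l l' :: 4
    by (metis lookup_single_eq lookup_single_not_eq zero_neq_one)
  show "F = lin4 ?c"
  proof (rule poly_mapping_eqI)
    fix m
    show "Poly_Mapping.lookup F m = Poly_Mapping.lookup (lin4 ?c) m"
    proof (cases "\<exists>l. m = Poly_Mapping.single l 1")
      case True
      then show ?thesis
        by (auto simp: lin4_def lookup_sum lookup_single when_def inj[unfolded One_nat_def])
    next
      case False
      then have "m \<notin> Poly_Mapping.keys F" using key by blast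
      moreover have "Poly_Mapping.single l (1::nat) \<noteq> m" for l using False by blast
      ultimately show ?thesis by (simp add: lin4_def lookup_sum lookup_single when_def in_keys_iff)
    qed
  qed
qed

lemma eval4_homogeneous_scale:
  assumes "homogeneous4 d F"
  shows "eval4 F (z *s x) = z ^ d * eval4 F x"
proof -
  have "mon4 m (z *s x) = z ^ d * mon4 m x" if "m \<in> Poly_Mapping.keys F" for m
  proof -
    have "mon4 m (z *s x) = (\<Prod>l\<in>UNIV. z ^ Poly_Mapping.lookup m l) * mon4 m x"
      by (simp only: mon4_def vector_smult_component power_mult_distrib prod.distrib)
    also have "(\<Prod>l\<in>UNIV. z ^ Poly_Mapping.lookup m l) = z ^ d"
      using assms that by (simp add: homogeneous4_def flip: power_sum)
    finally show ?thesis .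
  qed
  then show ?thesis
    by (simp add: eval4_mon4 sum_distrib_left algebra_simps cong: sum.cong)
qed

text \<open>Sorting a polynomial by degree is a ring homomorphism to univariate polynomials over
  \<open>poly4\<close> that maps the homogeneous polynomials to monomials, and factors of monomials are
  monomials.\<close>

definition graded :: "poly4 \<Rightarrow> poly4 poly" where
  "graded F = (\<Sum>m\<in>Poly_Mapping.keys F. monom (Poly_Mapping.single m (Poly_Mapping.lookup F m)) (deg4 m))"

lemma graded_mult: "graded (F * G) = graded F * graded G"
  unfolding graded_def
  by (rule keys_sum_mult[of "\<lambda>m a. monom (Poly_Mapping.single m a) (deg4 m)"])
     (simp_all add: single_add add_monom mult_monom mult_single lookup_add sum.distrib)

lemma graded_homogeneous:
  assumes "homogeneous4 d F"
  shows "graded F = monom F d"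
proof -
  have "graded F = (\<Sum>m\<in>Poly_Mapping.keys F. monom (Poly_Mapping.single m (Poly_Mapping.lookup F m)) d)"
    unfolding graded_def using assms by (intro sum.cong) (auto simp: homogeneous4_def)
  also have "\<dots> = monom (\<Sum>m\<in>Poly_Mapping.keys F. Poly_Mapping.single m (Poly_Mapping.lookup F m)) d"
    by (intro poly_eqI) (auto simp: coeff_sum)
  finally show ?thesis by (simp only: poly_mapping_sum_single)
qed

lemma homogeneous4_if_graded:
  assumes "graded F = monom G d"
  shows "homogeneous4 d F"
  unfolding homogeneous4_def
proof
  fix m assume m: "m \<in> Poly_Mapping.keys F"
  have "Poly_Mapping.lookup (coeff (graded F) (deg4 m)) m
      = (\<Sum>k\<in>Poly_Mapping.keys F. if k = m then Poly_Mapping.lookup F k else 0)"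
    unfolding graded_def coeff_sum coeff_monom lookup_sum
    by (intro sum.cong) (auto simp: lookup_single)
  also have "\<dots> = Poly_Mapping.lookup F m" using m by simp
  finally have "coeff (monom G d) (deg4 m) \<noteq> 0" using m assms by (metis in_keys_iff lookup_zero)
  then show "deg4 m = d" by (auto split: if_splits)
qed

lemma homogeneous4_factor:
  assumes "homogeneous4 d (H * K)" "H * K \<noteq> 0"
  shows "\<exists>e\<le>d. homogeneous4 e H \<and> homogeneous4 (d - e) K"
proof -
  have "graded H * graded K = monom (H * K) d"
    using graded_homogeneous[OF assms(1)] by (simp add: graded_mult)
  from monom_factor[OF this assms(2)] show ?thesis
    by (metis homogeneous4_if_graded)
qed

lemma dvd_prod_power_diff:
  fixes a b :: "'i \<Rightarrow> 'a::comm_ring_1"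
  assumes "\<And>i. i \<in> S \<Longrightarrow> d dvd a i - b i"
  shows "d dvd (\<Prod>i\<in>S. a i ^ n i) - (\<Prod>i\<in>S. b i ^ n i)"
  using assms
proof (induction S rule: infinite_finite_induct)
  case (insert i S)
  have "d dvd a i ^ n i - b i ^ n i"
    using insert.prems[of i] by (metis dvd_mult2 insertI1 power_diff_sumr2)
  moreover have "d dvd (\<Prod>i\<in>S. a i ^ n i) - (\<Prod>i\<in>S. b i ^ n i)" using insert by simp
  moreover have "a i ^ n i * A - b i ^ n i * B = (a i ^ n i - b i ^ n i) * A + b i ^ n i * (A - B)" for A B
    by (simp add: algebra_simps)
  ultimately show ?case using insert.hyps by (simp add: dvd_add dvd_mult dvd_mult2)
qed simp_all

text \<open>\<open>V i\<close> is the \<open>i\<close>-th coordinate of the projection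
  \<open>x - lf c x *s e\<close> onto the plane and is congruent to \<open>var4 i\<close> modulo
  \<open>lin4 c\<close>. So \<open>F\<close> is congruent to \<open>F\<close> with \<open>V\<close>
  substituted, which is zero because \<open>F\<close> vanishes on the plane.\<close>

lemma lin4_dvd:
  assumes "c \<noteq> 0" and vanish: "\<And>x. lf c x = 0 \<Longrightarrow> eval4 F x = 0"
  shows "lin4 c dvd F"
proof -
  obtain l where l: "c $ l \<noteq> 0" using \<open>c \<noteq> 0\<close> by (auto simp: vec_eq_iff)
  define e where "e = axis l (1 / c $ l)"
  have e: "lf c e = 1" using l by (simp add: e_def)
  define V where "V i = var4 i - lin4 c * const4 (e $ i)" for i
  have "F = (\<Sum>m\<in>Poly_Mapping.keys F. const4 (Poly_Mapping.lookup F m) * (\<Prod>i\<in>UNIV. var4 i ^ Poly_Mapping.lookup m i))"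
    by (rule eval4_inject) (simp add: eval4_mon4[of F] mon4_def)
  moreover have "0 = (\<Sum>m\<in>Poly_Mapping.keys F. const4 (Poly_Mapping.lookup F m) * (\<Prod>i\<in>UNIV. V i ^ Poly_Mapping.lookup m i))"
  proof (rule eval4_inject)
    fix x
    have "eval4 F (x - lf c x *s e) = 0" by (rule vanish) (simp add: e)
    then show "eval4 0 x = eval4 (\<Sum>m\<in>Poly_Mapping.keys F. const4 (Poly_Mapping.lookup F m) * (\<Prod>i\<in>UNIV. V i ^ Poly_Mapping.lookup m i)) x"
      by (simp add: eval4_mon4[of F] mon4_def V_def)
  qed
  ultimately have "F - 0 = (\<Sum>m\<in>Poly_Mapping.keys F. const4 (Poly_Mapping.lookup F m) *
      ((\<Prod>i\<in>UNIV. var4 i ^ Poly_Mapping.lookup m i) - (\<Prod>i\<in>UNIV. V i ^ Poly_Mapping.lookup m i)))"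
    by (simp only: right_diff_distrib sum_subtractf)
  then have "F = (\<Sum>m\<in>Poly_Mapping.keys F. const4 (Poly_Mapping.lookup F m) *
      ((\<Prod>i\<in>UNIV. var4 i ^ Poly_Mapping.lookup m i) - (\<Prod>i\<in>UNIV. V i ^ Poly_Mapping.lookup m i)))"
    by simp
  also have "lin4 c dvd \<dots>"
    by (intro dvd_sum dvd_mult dvd_prod_power_diff) (simp add: V_def)
  finally show ?thesis .
qed

subsection \<open>Polynomial functions of one variable\<close>

text \<open>Density arguments are made along lines: a polynomial identity that holds off the zeros
  of a nonzero polynomial extends to the whole line.\<close>

definition polyfun :: "(complex \<Rightarrow> complex) \<Rightarrow> bool" where
  "polyfun g \<longleftrightarrow> (\<exists>p. g = poly p)"

lemma polyfun_const: "polyfun (\<lambda>z. a)"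
  unfolding polyfun_def by (rule exI[of _ "[:a:]"]) auto

lemma polyfun_id: "polyfun (\<lambda>z. z)"
  unfolding polyfun_def by (rule exI[of _ "[:0, 1:]"]) auto

lemma polyfun_add:
  assumes "polyfun g" "polyfun h" shows "polyfun (\<lambda>z. g z + h z)"
proof -
  obtain p q where "g = poly p" "h = poly q" using assms by (auto simp: polyfun_def)
  then have "(\<lambda>z. g z + h z) = poly (p + q)" by auto
  then show ?thesis unfolding polyfun_def ..
qed

lemma polyfun_mult:
  assumes "polyfun g" "polyfun h" shows "polyfun (\<lambda>z. g z * h z)"
proof -
  obtain p q where "g = poly p" "h = poly q" using assms by (auto simp: polyfun_def)
  then have "(\<lambda>z. g z * h z) = poly (p * q)" by auto
  then show ?thesis unfolding polyfun_def ..
qed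

lemma polyfun_diff:
  assumes "polyfun g" "polyfun h" shows "polyfun (\<lambda>z. g z - h z)"
  using polyfun_add[OF assms(1) polyfun_mult[OF polyfun_const[of "-1"] assms(2)]] by simp

lemma polyfun_sum:
  "(\<And>i. i \<in> S \<Longrightarrow> polyfun (g i)) \<Longrightarrow> polyfun (\<lambda>z. \<Sum>i\<in>S. g i z)"
  by (induction S rule: infinite_finite_induct) (simp_all add: polyfun_const polyfun_add)

lemma polyfun_prod:
  "(\<And>i. i \<in> S \<Longrightarrow> polyfun (g i)) \<Longrightarrow> polyfun (\<lambda>z. \<Prod>i\<in>S. g i z)"
  by (induction S rule: infinite_finite_induct) (simp_all add: polyfun_const polyfun_mult)

lemma polyfun_power: "polyfun g \<Longrightarrow> polyfun (\<lambda>z. g z ^ n)"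
  by (induction n) (simp_all add: polyfun_const polyfun_mult)

lemmas polyfun_intros =
  polyfun_const polyfun_id polyfun_add polyfun_mult polyfun_diff polyfun_sum polyfun_prod polyfun_power

lemma polyfun_eval4:
  assumes "\<And>l. polyfun (\<lambda>z. X z $ l)"
  shows "polyfun (\<lambda>z. eval4 F (X z))"
  unfolding eval4_def by (intro polyfun_intros assms)

lemma polyfun_mult_eq_0:
  assumes "polyfun g" "polyfun h" and eq: "\<And>z. g z * h z = 0" and "h a \<noteq> 0"
  shows "g z = 0"
proof -
  obtain p q where pq: "g = poly p" "h = poly q" using assms by (auto simp: polyfun_def)
  have "p * q = 0" using eq poly_all_0_iff_0[of "p * q"] by (simp add: pq)
  moreover have "q \<noteq> 0" using \<open>h a \<noteq> 0\<close> by (auto simp: pq)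
  ultimately show ?thesis by (simp add: pq)
qed

lemma polyfun_eq_at_0:
  assumes "polyfun g" "polyfun h" and eq: "\<And>z. z \<noteq> 0 \<Longrightarrow> g z = h z"
  shows "g 0 = h 0"
proof -
  have "g 0 - h 0 = 0"
    by (rule polyfun_mult_eq_0[where h = "\<lambda>z. z" and a = 1 and g = "\<lambda>z. g z - h z"])
       (use assms in \<open>auto intro: polyfun_intros\<close>)
  then show ?thesis by simp
qed

lemma polyfun_no_zero_const:
  assumes "polyfun g" "\<And>z. g z \<noteq> 0"
  shows "g z = g 0"
proof -
  obtain p where "g = poly p" using assms by (auto simp: polyfun_def)
  moreover from this have "constant (poly p)"
    using fundamental_theorem_of_algebra assms(2) by metis
  ultimately show ?thesis by (auto simp: constant_def)
qed

subsection \<open>Surfaces contained in planes\<close>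

text \<open>A line through a point \<open>p\<close> of the plane and a point \<open>q\<close> outside of it meets every
  surface, by the fundamental theorem of algebra; if the surface lies in the plane, it can only meet it in \<open>p\<close>.\<close>

lemma zero_locus_in_plane:
  assumes hom: "homogeneous4 d F" and "d > 0" and "c \<noteq> 0"
    and sub: "zero_locus F \<subseteq> {x. lf c x = 0}"
  shows "zero_locus F = {x. x \<noteq> 0 \<and> lf c x = 0}"
proof -
  obtain q where q: "lf c q \<noteq> 0" using \<open>c \<noteq> 0\<close> lf_eq_0_iff[of c] by blast
  have "eval4 F p = 0" if p: "lf c p = 0" for p
  proof -
    \<comment> \<open>These points avoid the plane, so \<open>F\<close> has no zero along this
      affine line and is constant on it.\<close>
    have "eval4 F (q + z *s p) \<noteq> 0" for z
    proof -
      have "lf c (q + z *s p) \<noteq> 0" using p q by simp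
      moreover from this have "q + z *s p \<noteq> 0" by (metis lf_0_right)
      ultimately show ?thesis using sub by (auto simp: zero_locus_def simp del: lf_add_right)
    qed
    moreover have "polyfun (\<lambda>z. eval4 F (q + z *s p))"
      by (intro polyfun_eval4) (simp add: polyfun_intros)
    ultimately have const: "eval4 F (q + z *s p) = eval4 F q" for z
      using polyfun_no_zero_const[of "\<lambda>z. eval4 F (q + z *s p)" z] by simp
    \<comment> \<open>Homogeneity turns the constant into \<open>z ^ d * eval4 F q\<close> on a line
      through \<open>p\<close>; this extends to \<open>z = 0\<close> and vanishes there since
      \<open>d > 0\<close>.\<close>
    have "eval4 F (p + z *s q) = z ^ d * eval4 F q" if "z \<noteq> 0" for z
    proof -
      have "p + z *s q = z *s (q + (1 / z) *s p)"
        using that by (simp add: vec_eq_iff field_simps)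
      then show ?thesis by (simp only: eval4_homogeneous_scale[OF hom] const)
    qed
    moreover have "polyfun (\<lambda>z. eval4 F (p + z *s q))" "polyfun (\<lambda>z. z ^ d * eval4 F q)"
      by (intro polyfun_eval4, simp add: polyfun_intros) (intro polyfun_intros)
    ultimately have "eval4 F (p + 0 *s q) = 0 ^ d * eval4 F q"
      using polyfun_eq_at_0[of "\<lambda>z. eval4 F (p + z *s q)" "\<lambda>z. z ^ d * eval4 F q"] by blast
    then show ?thesis using \<open>d > 0\<close> by simp
  qed
  then show ?thesis using sub by (auto simp: zero_locus_def)
qed

lemma homogeneous4_irreducible_pos:
  assumes "homogeneous4 d F" "irreducible F"
  shows "d > 0"
proof (rule ccontr)
  assume "\<not> d > 0"
  then obtain c where c: "F = const4 c" using assms(1) homogeneous4_0_imp_const4[of F] by auto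
  then have "c \<noteq> 0" using assms(2) by (auto simp: const4_def irreducible_def)
  then have "F * const4 (1 / c) = 1" by (intro eval4_inject) (simp add: c)
  then have "F dvd 1" by (metis dvd_triv_left)
  then show False using assms(2) by (simp add: irreducible_def)
qed

lemma smooth_surface_in_plane:
  assumes "smooth_surface X" "c \<noteq> 0" "X \<subseteq> {x. lf c x = 0}"
  shows "X = {x. x \<noteq> 0 \<and> lf c x = 0}"
proof -
  obtain d F where F: "homogeneous4 d F" "irreducible F" "X = zero_locus F"
    using assms(1) by (auto simp: smooth_surface_def)
  show ?thesis
    using zero_locus_in_plane[OF F(1) homogeneous4_irreducible_pos[OF F(1,2)] assms(2)] assms(3)
    by (simp add: F(3))
qed

text \<open>Otherwise the quadric fills the plane and its equation is divisible by the linear form.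
  Neither factor is a unit, since both vanish at the origin, contrary to irreducibility.\<close>

lemma quadric_not_in_plane:
  assumes "quadric X" "X \<subseteq> {x. lf c x = 0}"
  shows "c = 0"
proof (rule ccontr)
  assume "c \<noteq> 0"
  obtain F where F: "homogeneous4 2 F" "irreducible F" "X = zero_locus F"
    using assms(1) by (auto simp: quadric_def)
  have X: "X = {x. x \<noteq> 0 \<and> lf c x = 0}"
    using zero_locus_in_plane[OF F(1) _ \<open>c \<noteq> 0\<close>] assms(2) by (simp add: F(3))
  have "eval4 F x = 0" if "lf c x = 0" for x
  proof (cases "x = 0")
    case True
    then show ?thesis using eval4_homogeneous_scale[OF F(1), of 0 x] by simp
  next
    case False
    then show ?thesis using X F(3) that by (auto simp: zero_locus_def)
  qed
  then obtain K where K: "F = lin4 c * K" using lin4_dvd[OF \<open>c \<noteq> 0\<close>] by (metis dvdE)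
  have unit: "eval4 G 0 \<noteq> 0" if "G dvd 1" for G
    using that by (metis dvdE eval4_mult eval4_one mult_zero_left zero_neq_one)
  obtain q where q: "lf c q \<noteq> 0" using \<open>c \<noteq> 0\<close> lf_eq_0_iff[of c] by blast
  have "eval4 K (z *s q) = z * eval4 K q" if "z \<noteq> 0" for z
    using eval4_homogeneous_scale[OF F(1), of z q] that q by (simp add: K power2_eq_square)
  moreover have "polyfun (\<lambda>z. eval4 K (z *s q))" "polyfun (\<lambda>z. z * eval4 K q)"
    by (intro polyfun_eval4, simp add: polyfun_intros) (intro polyfun_intros)
  ultimately have "eval4 K 0 = 0"
    using polyfun_eq_at_0[of "\<lambda>z. eval4 K (z *s q)" "\<lambda>z. z * eval4 K q"] by simp
  moreover have "lin4 c dvd 1 \<or> K dvd 1" using F(2) K by (simp add: irreducible_def)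
  ultimately show False using unit[of K] unit[of "lin4 c"] by auto
qed

subsection \<open>Linear algebra\<close>

lemma two_eq_zero_2 [simp]: "(2::2) = 0"
  by simp

lemma UNIV_2_01: "(UNIV :: 2 set) = {0, 1}"
  using UNIV_2 unfolding two_eq_zero_2 by (simp add: insert_commute)

lemma sum_2_01: "(\<Sum>i\<in>UNIV. f i) = f (0::2) + f 1"
  by (simp add: UNIV_2_01)

lemma forall_2_01: "(\<forall>i. Q i) \<longleftrightarrow> Q (0::2) \<and> Q 1"
  by (metis UNIV_2_01 UNIV_I insertE singletonD)

lemma cases_2_Suc: "i' = i \<or> i' = i + (1::2)"
proof -
  have "\<forall>i i'. i' = i \<or> i' = i + (1::2)" by (simp add: forall_2_01)
  then show ?thesis by blast
qed

lemma vec2_eq_iff: "(x::'a^2) = y \<longleftrightarrow> x $ 0 = y $ 0 \<and> x $ 1 = y $ 1"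
  by (simp add: vec_eq_iff forall_2_01)

lemma axis_2_01 [simp]: "axis (0::2) a $ 1 = 0" "axis (1::2) a $ 0 = 0"
  "axis i a $ i = a"
  by (simp_all add: axis_def)

lemma lf_commute: "lf c x = lf x c"
  by (simp add: lf_def mult.commute)

lemma lf_eqI: "(\<And>x. lf c x = lf d x) \<Longrightarrow> c = d"
  using lf_eq_0_iff[of "c - d"] by simp

lemma lf_proportional:
  assumes "\<And>x. lf a x = 0 \<Longrightarrow> lf b x = 0"
  shows "\<exists>k. b = k *s a"
proof (cases "a = 0")
  case True
  then have "b = 0" using assms lf_eq_0_iff by auto
  then show ?thesis using True by simp
next
  case False
  then obtain q where q: "lf a q \<noteq> 0" using lf_eq_0_iff by blast
  have "b = (lf b q / lf a q) *s a"
  proof (rule lf_eqI)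
    fix x
    have "lf b (x - (lf a x / lf a q) *s q) = 0" by (rule assms) (use q in simp)
    then show "lf b x = lf ((lf b q / lf a q) *s a) x" by (simp add: field_simps)
  qed
  then show ?thesis ..
qed

text \<open>If \<open>b\<close> is not identically zero on the plane of \<open>a\<close>,
  subtracting a multiple of \<open>b\<close> makes \<open>c\<close> vanish there, hence proportional
  to \<open>a\<close>; if it is, \<open>c\<close> itself vanishes there.\<close>

lemma lf_combination:
  assumes "\<And>x. lf a x = 0 \<Longrightarrow> lf b x = 0 \<Longrightarrow> lf c x = 0"
  shows "\<exists>p q. c = p *s a + q *s b"
proof (cases "\<exists>y. lf a y = 0 \<and> lf b y \<noteq> 0")
  case True
  then obtain y where y: "lf a y = 0" "lf b y \<noteq> 0" by blast
  define q where "q = lf c y / lf b y"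
  have "lf (c - q *s b) x = 0" if "lf a x = 0" for x
  proof -
    have "lf c (x - (lf b x / lf b y) *s y) = 0" by (rule assms) (use y that in simp_all)
    then show ?thesis by (simp add: q_def field_simps)
  qed
  then obtain p where "c - q *s b = p *s a" using lf_proportional by blast
  then have "c = p *s a + q *s b" by (simp add: diff_eq_eq)
  then show ?thesis by blast
next
  case False
  then have "lf c x = 0" if "lf a x = 0" for x using assms that by blast
  then obtain p where "c = p *s a + 0 *s b" using lf_proportional[of a c] by auto
  then show ?thesis by blast
qed

text \<open>A nonzero kernel and dependent rows both mean that a square matrix is not invertible,
  because its one-sided inverses are two-sided.\<close>

lemma annihilator_exists_iff:
  fixes v :: "'n::finite \<Rightarrow> complex^'n"
  shows "(\<exists>c. c \<noteq> 0 \<and> (\<forall>l. lf c (v l) = 0)) \<longleftrightarrow> (\<exists>r. (\<Sum>l\<in>UNIV. r l *s v l) = 0 \<and> (\<exists>l. r l \<noteq> 0))"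
proof -
  define M where "M = (\<chi> l. v l)"
  have "M *v c = 0 \<longleftrightarrow> (\<forall>l. lf c (v l) = 0)" for c
    by (simp add: vec_eq_iff matrix_vector_mult_def M_def lf_def mult.commute)
  then have "(\<exists>c. c \<noteq> 0 \<and> (\<forall>l. lf c (v l) = 0)) \<longleftrightarrow> (\<exists>c. c \<noteq> 0 \<and> M *v c = 0)"
    by simp
  also have "\<dots> \<longleftrightarrow> \<not> (\<exists>B. B ** M = mat 1)" using matrix_left_invertible_ker by metis
  also have "\<dots> \<longleftrightarrow> \<not> (\<exists>B. M ** B = mat 1)" using matrix_left_right_inverse by metis
  also have "\<dots> \<longleftrightarrow> (\<exists>r. (\<Sum>l\<in>UNIV. r l *s v l) = 0 \<and> (\<exists>l. r l \<noteq> 0))"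
    unfolding matrix_right_invertible_independent_rows by (auto simp: row_def M_def)
  finally show ?thesis .
qed

lemma annihilator4_exists_iff:
  fixes v1 v2 v3 v4 :: "complex^4"
  shows "(\<exists>c. c \<noteq> 0 \<and> lf c v1 = 0 \<and> lf c v2 = 0 \<and> lf c v3 = 0 \<and> lf c v4 = 0) \<longleftrightarrow>
    (\<exists>p q r s. p *s v1 + q *s v2 + r *s v3 + s *s v4 = 0 \<and> \<not> (p = 0 \<and> q = 0 \<and> r = 0 \<and> s = 0))"
    (is "?L \<longleftrightarrow> ?R")
proof -
  define v where "v = (\<lambda>l::4. if l = 1 then v1 else if l = 2 then v2 else if l = 3 then v3 else v4)"
  have v: "v 1 = v1" "v 2 = v2" "v 3 = v3" "v 4 = v4" by (simp_all add: v_def)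
  have "?L \<longleftrightarrow> (\<exists>c. c \<noteq> 0 \<and> (\<forall>l. lf c (v l) = 0))" by (simp add: forall_4 v)
  also have "\<dots> \<longleftrightarrow> (\<exists>r. r 1 *s v1 + r 2 *s v2 + r 3 *s v3 + r 4 *s v4 = 0 \<and>
      \<not> (r 1 = 0 \<and> r 2 = 0 \<and> r 3 = 0 \<and> r (4::4) = 0))"
    unfolding annihilator_exists_iff by (simp add: sum_4 v flip: not_all) (simp add: forall_4)
  also have "\<dots> \<longleftrightarrow> ?R"
  proof
    assume ?R
    then obtain p q r s where *: "p *s v1 + q *s v2 + r *s v3 + s *s v4 = 0"
      "\<not> (p = 0 \<and> q = 0 \<and> r = 0 \<and> s = 0)" by blast
    show "\<exists>r. r 1 *s v1 + r 2 *s v2 + r 3 *s v3 + r 4 *s v4 = 0 \<and>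
      \<not> (r 1 = 0 \<and> r 2 = 0 \<and> r 3 = 0 \<and> r (4::4) = 0)"
      by (rule exI[of _ "\<lambda>l::4. if l = 1 then p else if l = 2 then q else if l = 3 then r else s"])
         (use * in simp)
  qed blast
  finally show ?thesis .
qed

lemma annihilator3_exists:
  fixes v1 v2 v3 :: "complex^4"
  shows "\<exists>c. c \<noteq> 0 \<and> lf c v1 = 0 \<and> lf c v2 = 0 \<and> lf c v3 = 0"
proof -
  \<comment> \<open>Repeating \<open>v3\<close> makes four dependent vectors out of three.\<close>
  have "0 *s v1 + 0 *s v2 + 1 *s v3 + (- 1) *s v3 = 0" by (simp add: vec_eq_iff)
  then show ?thesis using annihilator4_exists_iff[of v1 v2 v3 v3] by (metis one_neq_zero)
qed

text \<open>A form that does not vanish at a common zero of \<open>a\<close>, \<open>b\<close>,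
  \<open>c\<close> is independent of them, and four independent forms have only the trivial common
  zero. This supplies the fourth coordinate \<open>\<zeta>\<close>.\<close>

lemma extend_to_dual_basis:
  fixes a b c :: "complex^4"
  assumes indep: "\<And>p q r. p *s a + q *s b + r *s c = 0 \<Longrightarrow> p = 0 \<and> q = 0 \<and> r = 0"
  shows "\<exists>d. \<forall>x. lf a x = 0 \<longrightarrow> lf b x = 0 \<longrightarrow> lf c x = 0 \<longrightarrow> lf d x = 0 \<longrightarrow> x = 0"
proof -
  obtain x where x: "x \<noteq> 0" "lf x a = 0" "lf x b = 0" "lf x c = 0"
    using annihilator3_exists by blast
  then obtain d where d: "lf x d \<noteq> 0" using lf_eq_0_iff[of x] by blast
  have "p = 0 \<and> q = 0 \<and> r = 0 \<and> s = 0" if "p *s a + q *s b + r *s c + s *s d = 0" for p q r s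
  proof -
    have "lf x (p *s a + q *s b + r *s c + s *s d) = 0" using that by simp
    then have "s = 0" using x d by simp
    then show ?thesis using indep that by simp
  qed
  then have "\<not> (y \<noteq> 0 \<and> lf y a = 0 \<and> lf y b = 0 \<and> lf y c = 0 \<and> lf y d = 0)" for y
    using annihilator4_exists_iff[of a b c d] by blast
  then show ?thesis unfolding lf_commute[of _ a] lf_commute[of _ b] lf_commute[of _ c] lf_commute[of _ d]
    by (metis lf_commute)
qed

subsection \<open>The plane boundary surfaces\<close>

lemma join_eq_span: "join p q = vec.span {p, q} - {0}"
proof -
  have "x \<in> vec.span {p, q} \<longleftrightarrow> (\<exists>a b. x = a *s p + b *s q)" for x
  proof -
    have "x \<in> vec.span {p, q} \<longleftrightarrow> (\<exists>a b. x - a *s p = b *s q)"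
      by (simp add: vec.span_breakdown_eq vec.span_singleton image_iff)
    then show ?thesis by (simp add: diff_eq_eq add.commute)
  qed
  then show ?thesis by (auto simp: join_def)
qed

lemma is_line_imp_dim:
  assumes "is_line (join p q)"
  shows "vec.dim {p, q} = 2"
proof -
  obtain p' q' where *: "p' \<noteq> 0" "q' \<noteq> 0" "\<not> same_point p' q'" "join p q = join p' q'"
    using assms by (auto simp: is_line_def)
  have "q' \<noteq> k *s p'" for k
    using * by (cases "k = 0") (auto simp: same_point_def)
  then have "vec.independent {p', q'}" "p' \<noteq> q'"
    using * by (auto simp: vec.independent_insert vec.span_singleton insert_commute[of p' q'])
       (metis vector_smult_lid)+
  then have "vec.dim {p', q'} = 2" by (simp add: vec.dim_eq_card_independent)
  moreover have "vec.span {p, q} = vec.span {p', q'}"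
    using *(4) vec.span_zero[of "{p, q}"] vec.span_zero[of "{p', q'}"]
    unfolding join_eq_span by (metis insert_Diff)
  ultimately show ?thesis by (metis vec.dim_span)
qed

lemma join_eq_span_if_is_line:
  assumes "is_line (join p q)" "p \<in> vec.span {e, f}" "q \<in> vec.span {e, f}"
  shows "join p q = vec.span {e, f} - {0}"
proof -
  have "vec.span {p, q} = vec.span {e, f}"
  proof (rule vec.subspace_dim_equal)
    show "vec.span {p, q} \<subseteq> vec.span {e, f}"
      using assms(2,3) by (intro vec.span_minimal) auto
    have "vec.dim (vec.span {e, f}) \<le> card {e, f}" by (intro vec.dim_le_card) auto
    also have "\<dots> \<le> 2" by (simp add: card_insert_if)
    finally show "vec.dim (vec.span {e, f}) \<le> vec.dim (vec.span {p, q})"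
      using is_line_imp_dim[OF assms(1)] by simp
  qed simp_all
  then show ?thesis by (simp add: join_eq_span)
qed

lemma zariski_closure_subset_plane:
  assumes "S \<subseteq> {x. lf c x = 0}"
  shows "zariski_closure S \<subseteq> {x. lf c x = 0}"
  using assms homogeneous4_lin4[of c] unfolding zariski_closure_def
  by (force dest: spec[of _ "lin4 c"] )

lemma lf_trilinear_map:
  "lf c (trilinear_map w P s t u) =
     (\<Sum>i\<in>UNIV. \<Sum>j\<in>UNIV. \<Sum>k\<in>UNIV. of_real (w i j k) * lf c (cvec (P i j k)) * s $ i * t $ j * u $ k)"
  by (simp add: trilinear_map_def algebra_simps)

text \<open>Exchanges the parameters s and t, hence the roles of \<Sigma> and T, so that statements
  about planes and slices are proved once.\<close>

definition swap :: "('a \<Rightarrow> 'a \<Rightarrow> 'b \<Rightarrow> 'c) \<Rightarrow> 'a \<Rightarrow> 'a \<Rightarrow> 'b \<Rightarrow> 'c" where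
  "swap f = (\<lambda>i j k. f j i k)"

lemma swap_apply [simp]: "swap f i j k = f j i k"
  by (simp add: swap_def)

lemma trilinear_map_swap: "trilinear_map (swap w) (swap P) s t u = trilinear_map w P t s u"
  unfolding trilinear_map_def by (subst sum.swap) (simp add: algebra_simps)

lemma \<Sigma>_surface_swap: "\<Sigma>_surface (swap w) (swap P) = T_surface w P"
  and T_surface_swap: "T_surface (swap w) (swap P) = \<Sigma>_surface w P"
  and u_line_swap: "u_line (swap P) i j = u_line P j i"
  by (auto simp: \<Sigma>_surface_def T_surface_def Y_surface_def trilinear_map_swap u_line_def
      intro!: ext arg_cong[of _ _ zariski_closure])

lemma Y_surface_swap: "Y_surface (swap w) (swap P) = Y_surface w P"
  unfolding Y_surface_def trilinear_map_swap
  by (intro ext arg_cong[of _ _ zariski_closure]) blast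

section \<open>Spanning and coplanarity of the control points\<close>

locale pyramid =
  fixes w :: weights and P :: control_points and A :: "complex^4"
  assumes A_in_u_line: "A \<in> u_line P i j"
    and quadric_Y: "quadric (Y_surface w P k)"
    and smooth_\<Sigma>: "smooth_surface (\<Sigma>_surface w P i)"
    and smooth_T: "smooth_surface (T_surface w P j)"
    and Y_neq: "Y_surface w P 0 \<noteq> Y_surface w P 1"
    and \<Sigma>_neq_T: "\<Sigma>_surface w P i \<noteq> T_surface w P j"
    and is_line_u: "is_line (u_line P i j)"
    and u_line_neq: "u_line P i 0 \<noteq> u_line P i 1" "u_line P 0 j \<noteq> u_line P 1 j"
begin

abbreviation p :: "2 \<Rightarrow> 2 \<Rightarrow> 2 \<Rightarrow> complex^4" where "p i j k \<equiv> cvec (P i j k)"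

lemma pyramid_swap: "pyramid (swap w) (swap P) A"
  by unfold_locales
     (simp_all add: A_in_u_line quadric_Y smooth_\<Sigma> smooth_T is_line_u u_line_neq Y_neq \<Sigma>_neq_T[symmetric]
       \<Sigma>_surface_swap T_surface_swap Y_surface_swap u_line_swap)

text \<open>Such a form vanishes on the image of the face \<open>k\<close>, hence on its closure,
  and no plane contains a quadric.\<close>

lemma weighted_spanning:
  assumes "\<And>i j. w i j k = 0 \<or> lf c (p i j k) = 0"
  shows "c = 0"
proof (rule quadric_not_in_plane[OF quadric_Y[of k]])
  have "lf c (trilinear_map w P s t (axis k 1)) = 0" for s t
    unfolding lf_trilinear_map
    by (intro sum.neutral ballI) (use assms in \<open>auto simp: axis_def\<close>)
  then show "Y_surface w P k \<subseteq> {x. lf c x = 0}"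
    unfolding Y_surface_def by (intro zariski_closure_subset_plane) auto
qed

lemma spanning:
  assumes "\<And>i j. lf c (p i j k) = 0"
  shows "c = 0"
  using assms weighted_spanning by blast

text \<open>A vanishing weight leaves only three weighted control points on
  \<open>Y_surface w P k\<close>, and three points always lie in a plane.\<close>

lemma weight_nonzero: "w i j k \<noteq> 0"
proof
  assume w: "w i j k = 0"
  obtain c where "c \<noteq> 0" and c: "lf c (p i (j+1) k) = 0" "lf c (p (i+1) j k) = 0" "lf c (p (i+1) (j+1) k) = 0"
    using annihilator3_exists by blast
  have "w i' j' k = 0 \<or> lf c (p i' j' k) = 0" for i' j'
    using w c cases_2_Suc[of i' i] cases_2_Suc[of j' j] by auto
  then show False using weighted_spanning \<open>c \<noteq> 0\<close> by blast
qed

text \<open>Both \<open>u_line P i 0\<close> and \<open>u_line P i 1\<close> contain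
  \<open>A\<close>; the two expressions for \<open>A\<close> give a linear dependence, so the four
  control points are coplanar. The smooth surface then fills their plane.\<close>

lemma \<Sigma>_plane_exists:
  "\<exists>c. (\<forall>j k. lf c (p i j k) = 0) \<and> c \<noteq> 0 \<and> \<Sigma>_surface w P i = {x. x \<noteq> 0 \<and> lf c x = 0}"
proof -
  obtain a b a' b' where A: "A = a *s p i 0 0 + b *s p i 0 1" "A = a' *s p i 1 0 + b' *s p i 1 1" and "A \<noteq> 0"
    using A_in_u_line[of i 0] A_in_u_line[of i 1] by (auto simp: u_line_def join_def)
  have "a *s p i 0 0 + b *s p i 0 1 + (- a') *s p i 1 0 + (- b') *s p i 1 1 = A - A"
    by (subst A(1), subst A(2)) (simp add: vec_eq_iff)
  moreover have "\<not> (a = 0 \<and> b = 0 \<and> - a' = 0 \<and> - b' = 0)" using A \<open>A \<noteq> 0\<close> by auto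
  ultimately obtain c where "c \<noteq> 0" and c: "lf c (p i 0 0) = 0" "lf c (p i 0 1) = 0" "lf c (p i 1 0) = 0" "lf c (p i 1 1) = 0"
    using annihilator4_exists_iff[of "p i 0 0" "p i 0 1" "p i 1 0" "p i 1 1"] by (metis diff_self)
  have c: "\<forall>j k. lf c (p i j k) = 0" using c by (simp add: forall_2_01)
  have "lf c (trilinear_map w P (axis i 1) t u) = 0" for t u
    unfolding lf_trilinear_map
    by (intro sum.neutral ballI) (use c in \<open>auto simp: axis_def\<close>)
  then have "\<Sigma>_surface w P i \<subseteq> {x. lf c x = 0}"
    unfolding \<Sigma>_surface_def by (intro zariski_closure_subset_plane) auto
  then show ?thesis using smooth_surface_in_plane[OF smooth_\<Sigma> \<open>c \<noteq> 0\<close>] \<open>c \<noteq> 0\<close> c by blast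
qed

end

lemma (in pyramid) T_plane_exists:
  "\<exists>c. (\<forall>i k. lf c (p i j k) = 0) \<and> c \<noteq> 0 \<and> T_surface w P j = {x. x \<noteq> 0 \<and> lf c x = 0}"
  using pyramid.\<Sigma>_plane_exists[OF pyramid_swap, of j] by (simp add: \<Sigma>_surface_swap)

locale pyramid_planes = pyramid +
  fixes \<sigma> \<tau> :: "2 \<Rightarrow> complex^4"
  assumes \<sigma>_vanish: "lf (\<sigma> i) (cvec (P i j k)) = 0" and \<sigma>_nonzero: "\<sigma> i \<noteq> 0"
    and \<Sigma>_eq: "\<Sigma>_surface w P i = {x. x \<noteq> 0 \<and> lf (\<sigma> i) x = 0}"
    and \<tau>_vanish: "lf (\<tau> j) (cvec (P i j k)) = 0" and \<tau>_nonzero: "\<tau> j \<noteq> 0"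
    and T_eq: "T_surface w P j = {x. x \<noteq> 0 \<and> lf (\<tau> j) x = 0}"
begin

lemma planes_swap: "pyramid_planes (swap w) (swap P) A \<tau> \<sigma>"
proof -
  interpret swapped: pyramid "swap w" "swap P" A by (rule pyramid_swap)
  show ?thesis
    by unfold_locales
       (use \<Sigma>_eq T_eq in \<open>simp_all add: \<sigma>_vanish \<tau>_vanish \<sigma>_nonzero \<tau>_nonzero \<Sigma>_surface_swap T_surface_swap\<close>)
qed

lemma \<sigma>_neq_scaled_\<tau>: "\<sigma> i \<noteq> r *s \<tau> j"
proof
  assume *: "\<sigma> i = r *s \<tau> j"
  then have "r \<noteq> 0" using \<sigma>_nonzero[of i] by auto
  then have "\<Sigma>_surface w P i = T_surface w P j" by (simp add: \<Sigma>_eq T_eq *)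
  then show False using \<Sigma>_neq_T by blast
qed

text \<open>Otherwise the lines \<open>u\<^sub>i\<^sub>0\<close> and \<open>u\<^sub>i\<^sub>1\<close> would both lie in \<open>T\<^sub>0 \<inter> T\<^sub>1\<close>.\<close>

lemma \<sigma>_not_in_pencil: "\<sigma> i \<noteq> r *s \<tau> 0 + r' *s \<tau> 1"
proof
  assume eq: "\<sigma> i = r *s \<tau> 0 + r' *s \<tau> 1"
  have nz: "r \<noteq> 0" "r' \<noteq> 0" using eq \<sigma>_neq_scaled_\<tau>[of i r' 1] \<sigma>_neq_scaled_\<tau>[of i r 0] by auto
  have "lf (\<sigma> i) (p i j k) = r * lf (\<tau> 0) (p i j k) + r' * lf (\<tau> 1) (p i j k)" for j k
    by (simp add: eq)
  then have "0 = r * lf (\<tau> 0) (p i j k) + r' * lf (\<tau> 1) (p i j k)" for j k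
    by (simp add: \<sigma>_vanish)
  \<comment> \<open>At the control points on \<open>u_line P i j\<close> both
    \<open>\<sigma> i\<close> and \<open>\<tau> j\<close> vanish, so the other \<tau> vanishes
    too.\<close>
  from this[of 0] this[of 1] have "lf (\<tau> 1) (p i 0 k) = 0" "lf (\<tau> 0) (p i 1 k) = 0" for k
    using nz by (simp_all add: \<tau>_vanish)
  then have "\<forall>j j'. lf (\<tau> j') (p i j k) = 0" for k
    by (simp add: forall_2_01 \<tau>_vanish)
  then have K: "lf (\<tau> j') (p i j k) = 0" for j j' k by blast
  let ?i = "i + 1"
  have ext: "c = 0" if "lf c (p i 0 0) = 0" "lf c (p i 1 0) = 0" "lf c (p ?i 0 0) = 0" "lf c (p ?i 1 0) = 0" for c
  proof (rule spanning)
    have "\<forall>j. lf c (p i' j 0) = 0" for i'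
      using that cases_2_Suc[of i' i] by (auto simp: forall_2_01)
    then show "lf c (p i' j 0) = 0" for i' j by blast
  qed
  have nz0: "lf (\<tau> 0) (p ?i 1 0) \<noteq> 0" and nz1: "lf (\<tau> 1) (p ?i 0 0) \<noteq> 0"
    using ext[of "\<tau> 0"] ext[of "\<tau> 1"] \<tau>_nonzero by (auto simp: K \<tau>_vanish)
  have span: "x \<in> vec.span {p i 0 0, p i 1 0}" if x: "lf (\<tau> 0) x = 0" "lf (\<tau> 1) x = 0" for x
  proof -
    have "lf x c = 0" if c: "lf (p i 0 0) c = 0" "lf (p i 1 0) c = 0" for c
    proof -
      \<comment> \<open>\<open>q0\<close> and \<open>q1\<close> make \<open>?c\<close> vanish also
        at the two remaining control points of \<open>Y_surface w P 0\<close>. The four points span,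
        so \<open>c\<close> lies in the pencil of \<open>\<tau> 0\<close> and
        \<open>\<tau> 1\<close>.\<close>
      define q0 q1 where "q0 = lf c (p ?i 1 0) / lf (\<tau> 0) (p ?i 1 0)" and "q1 = lf c (p ?i 0 0) / lf (\<tau> 1) (p ?i 0 0)"
      let ?c = "c - q0 *s \<tau> 0 - q1 *s \<tau> 1"
      have "lf ?c (p i 0 0) = 0" "lf ?c (p i 1 0) = 0"
        using c by (simp_all add: K lf_commute[of "p _ _ _" c])
      moreover have "lf ?c (p ?i 0 0) = 0" "lf ?c (p ?i 1 0) = 0"
        using nz0 nz1 by (simp_all add: \<tau>_vanish q0_def q1_def)
      ultimately have "?c = 0" by (rule ext)
      then have "c = q0 *s \<tau> 0 + q1 *s \<tau> 1" by (simp add: algebra_simps)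
      then have "lf c x = 0" using x by simp
      then show ?thesis by (simp add: lf_commute)
    qed
    then obtain a b where "x = a *s p i 0 0 + b *s p i 1 0" using lf_combination by blast
    then show ?thesis by (simp add: vec.span_add vec.span_scale vec.span_base)
  qed
  have "u_line P i j = vec.span {p i 0 0, p i 1 0} - {0}" for j
    using is_line_u[of i j] unfolding u_line_def
    by (intro join_eq_span_if_is_line) (auto intro!: span K)
  then show False using u_line_neq(1)[of i] by simp
qed

end

lemma lf_cvec: "lf (cvec v) (cvec x) = of_real (v \<bullet> x)"
  by (simp add: lf_def cvec_def inner_vec_def)

lemma cvec_eq_0_iff [simp]: "cvec v = 0 \<longleftrightarrow> v = 0"
  by (simp add: cvec_def vec_eq_iff)

lemma real_plane_eq: "real_plane v = {x. x \<noteq> 0 \<and> lf (cvec v) x = 0}"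
  by (simp add: real_plane_def lf_def cvec_def)

text \<open>\<open>v\<close> lies in both pencils. Were one coefficient zero, \<open>v\<close> would
  be a multiple of some \<open>\<sigma> i\<close>, which would then lie in the pencil of
  \<open>\<tau> 0\<close> and \<open>\<tau> 1\<close>.\<close>

lemma (in pyramid_planes) pencil_coefficients:
  assumes "v \<noteq> 0"
    and \<Sigma>: "\<Sigma>_surface w P 0 \<inter> \<Sigma>_surface w P 1 \<subseteq> real_plane v"
    and T: "T_surface w P 0 \<inter> T_surface w P 1 \<subseteq> real_plane v"
  shows "\<exists>k :: 2 \<Rightarrow> complex. (\<forall>i. k i \<noteq> 0) \<and> cvec v = k 0 *s \<sigma> 0 + k 1 *s \<sigma> 1"
proof -
  have "lf (cvec v) x = 0" if "lf (\<sigma> 0) x = 0" "lf (\<sigma> 1) x = 0" for x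
    using \<Sigma> that by (cases "x = 0") (auto simp: \<Sigma>_eq real_plane_eq)
  then obtain k0 k1 where k: "cvec v = k0 *s \<sigma> 0 + k1 *s \<sigma> 1" using lf_combination by blast
  have "lf (cvec v) x = 0" if "lf (\<tau> 0) x = 0" "lf (\<tau> 1) x = 0" for x
    using T that by (cases "x = 0") (auto simp: T_eq real_plane_eq)
  then obtain m0 m1 where m: "cvec v = m0 *s \<tau> 0 + m1 *s \<tau> 1" using lf_combination by blast
  have not_multiple: "cvec v \<noteq> r *s \<sigma> i" for r i
  proof
    assume *: "cvec v = r *s \<sigma> i"
    then have "r \<noteq> 0" using \<open>v \<noteq> 0\<close> by (metis cvec_eq_0_iff vector_smult_lzero)
    then have "\<sigma> i = (1 / r) *s cvec v" by (simp add: *)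
    also have "\<dots> = (m0 / r) *s \<tau> 0 + (m1 / r) *s \<tau> 1"
      by (simp add: m vector_add_ldistrib)
    finally show False using \<sigma>_not_in_pencil by blast
  qed
  have "k0 \<noteq> 0" "k1 \<noteq> 0" using k not_multiple[of k1 1] not_multiple[of k0 0] by auto
  then show ?thesis
    using k by (intro exI[of _ "\<lambda>i. if i = 0 then k0 else k1"]) simp
qed

section \<open>Scaled plane forms and the weight tensor\<close>

locale scaled_pyramid = pyramid_planes +
  fixes v :: "real^4"
  assumes v_nonzero: "v \<noteq> 0"
    and sum_\<sigma>: "\<sigma> 0 + \<sigma> 1 = cvec v" and sum_\<tau>: "\<tau> 0 + \<tau> 1 = cvec v"

lemma (in pyramid_planes) scaled_pyramid_exists:
  assumes "v \<noteq> 0"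
    and "\<Sigma>_surface w P 0 \<inter> \<Sigma>_surface w P 1 \<subseteq> real_plane v"
    and "T_surface w P 0 \<inter> T_surface w P 1 \<subseteq> real_plane v"
  shows "\<exists>\<sigma> \<tau>. scaled_pyramid w P A \<sigma> \<tau> v"
proof -
  obtain k :: "2 \<Rightarrow> complex" where k: "\<And>i. k i \<noteq> 0" "cvec v = k 0 *s \<sigma> 0 + k 1 *s \<sigma> 1"
    using pencil_coefficients[OF assms] by blast
  obtain m :: "2 \<Rightarrow> complex" where m: "\<And>i. m i \<noteq> 0" "cvec v = m 0 *s \<tau> 0 + m 1 *s \<tau> 1"
    using pyramid_planes.pencil_coefficients[OF planes_swap, of v] assms
    by (auto simp: \<Sigma>_surface_swap T_surface_swap)
  have "scaled_pyramid w P A (\<lambda>i. k i *s \<sigma> i) (\<lambda>j. m j *s \<tau> j) v"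
    by unfold_locales
       (use k m \<open>v \<noteq> 0\<close> in \<open>simp_all add: \<sigma>_vanish \<tau>_vanish \<sigma>_nonzero \<tau>_nonzero \<Sigma>_eq T_eq\<close>)
  then show ?thesis by blast
qed

context scaled_pyramid
begin

lemma scaled_swap: "scaled_pyramid (swap w) (swap P) A \<tau> \<sigma> v"
proof -
  interpret swapped: pyramid_planes "swap w" "swap P" A \<tau> \<sigma> by (rule planes_swap)
  show ?thesis by unfold_locales (simp_all add: v_nonzero sum_\<sigma> sum_\<tau>)
qed

definition W :: "2 \<Rightarrow> 2 \<Rightarrow> 2 \<Rightarrow> real" where
  "W i j k = w i j k * (v \<bullet> P i j k)"

text \<open>Addition in the type \<open>2\<close> is modulo 2, so \<open>i + 1\<close> is the index other than \<open>i\<close>.\<close>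

lemma lf_\<sigma>_p: "lf (\<sigma> (i + 1)) (p i' j k) = (if i' = i then of_real (v \<bullet> P i j k) else 0)"
proof (cases "i' = i")
  case True
  \<comment> \<open>At the control points where \<open>\<sigma> i\<close> vanishes, the scaling
    gives \<open>\<sigma> (i + 1)\<close> the value of \<open>v\<close>.\<close>
  have "\<forall>i. \<sigma> i + \<sigma> (i + 1) = cvec v"
    unfolding forall_2_01 using sum_\<sigma> by (simp add: two_eq_zero_2 add.commute)
  then have "lf (\<sigma> i) (p i j k) + lf (\<sigma> (i + 1)) (p i j k) = lf (cvec v) (p i j k)"
    by (metis lf_add_left)
  then show ?thesis using True by (simp add: \<sigma>_vanish lf_cvec)
next
  case False
  then have "i' = i + 1" using cases_2_Suc by blast
  then show ?thesis using False by (simp add: \<sigma>_vanish)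
qed

lemma lf_\<sigma>_trilinear_map:
  "lf (\<sigma> (i + 1)) (trilinear_map w P s t u) =
     s $ i * (\<Sum>j\<in>UNIV. \<Sum>k\<in>UNIV. of_real (W i j k) * t $ j * u $ k)"
proof -
  have "lf (\<sigma> (i + 1)) (trilinear_map w P s t u) = (\<Sum>i'\<in>UNIV. if i' = i then
      (\<Sum>j\<in>UNIV. \<Sum>k\<in>UNIV. of_real (w i j k) * of_real (v \<bullet> P i j k) * s $ i * t $ j * u $ k) else 0)"
    unfolding lf_trilinear_map lf_\<sigma>_p by (intro sum.cong) auto
  also have "\<dots> = s $ i * (\<Sum>j\<in>UNIV. \<Sum>k\<in>UNIV. of_real (W i j k) * t $ j * u $ k)"
    by (simp add: W_def sum_distrib_left algebra_simps)
  finally show ?thesis .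
qed

text \<open>Otherwise \<open>\<sigma> (i + 1)\<close> would vanish at all control points with last
  index 0, which span: on its own face always, on the face \<open>i\<close> because \<open>v\<close>
  does.\<close>

lemma W_slice_nonzero: "\<exists>j k. W i j k \<noteq> 0"
proof (rule ccontr)
  assume "\<not> ?thesis"
  then have "v \<bullet> P i j k = 0" for j k by (simp add: W_def weight_nonzero)
  then have "lf (\<sigma> (i + 1)) (p i' j 0) = 0" for i' j by (simp add: lf_\<sigma>_p)
  then show False using spanning[of "\<sigma> (i + 1)"] \<sigma>_nonzero by blast
qed

lemma W_slice_nonzero3: "\<exists>i j. W i j k \<noteq> 0"
proof (rule ccontr)
  assume "\<not> ?thesis"
  then have "v \<bullet> P i j k = 0" for i j by (simp add: W_def weight_nonzero)
  then have "lf (cvec v) (p i j k) = 0" for i j by (simp add: lf_cvec)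
  then show False using spanning[of "cvec v"] v_nonzero by (metis cvec_eq_0_iff)
qed

end

subsection \<open>From the inverse map to the rank one tensor\<close>

lemma polyfun_trilinear_map:
  "polyfun (\<lambda>z. trilinear_map w P (s + z *s s') (t + z *s t') (u + z *s u') $ l)"
  unfolding trilinear_map_def
  by (simp add: sum_component) (intro polyfun_intros)

text \<open>The inverse relation is given only where the composite is defined. An arbitrary
  parameter triple is joined by a line to one such triple, and the cross-product identity extends
  along it.\<close>

lemma inverse_map_identities:
  fixes w P defines "f \<equiv> trilinear_map w P"
  assumes inv: "inverse_map f A B C"
  shows "s $ 0 * eval4 (A 1) (f s t u) = s $ 1 * eval4 (A 0) (f s t u)" (is ?A)
    and "t $ 0 * eval4 (B 1) (f s t u) = t $ 1 * eval4 (B 0) (f s t u)" (is ?B)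
    and "\<exists>s t u. pair_map A (f s t u) \<noteq> 0 \<and> pair_map B (f s t u) \<noteq> 0"
proof -
  define D where "D = {x. x \<noteq> 0 \<and> pair_map A x \<noteq> 0 \<and> pair_map B x \<noteq> 0 \<and> pair_map C x \<noteq> 0}"
  obtain s0 t0 u0 where 0: "s0 \<noteq> 0" "t0 \<noteq> 0" "u0 \<noteq> 0" "f s0 t0 u0 \<in> D"
    using inv unfolding inverse_map_def Let_def D_def by blast
  then show "\<exists>s t u. pair_map A (f s t u) \<noteq> 0 \<and> pair_map B (f s t u) \<noteq> 0"
    by (auto simp: D_def)
  have D: "same_point s (pair_map A (f s t u)) \<and> same_point t (pair_map B (f s t u))"
    if "s \<noteq> 0" "t \<noteq> 0" "u \<noteq> 0" "f s t u \<in> D" for s t u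
    using inv that unfolding inverse_map_def Let_def D_def by blast
  have cross: "x $ 0 * eval4 (F 1) y = x $ 1 * eval4 (F 0) y" if "same_point x (pair_map F y)" for x F y
    using that by (auto simp: same_point_def pair_map_def vec2_eq_iff)
  have comp: "\<exists>l. x $ l \<noteq> 0" if "x \<noteq> 0" for x :: "complex^'n" using that by (auto simp: vec_eq_iff)
  obtain l1 l2 l3 l4 i j k where nz: "s0 $ l1 \<noteq> 0" "t0 $ l2 \<noteq> 0" "u0 $ l3 \<noteq> 0" "f s0 t0 u0 $ l4 \<noteq> 0"
    "eval4 (A i) (f s0 t0 u0) \<noteq> 0" "eval4 (B j) (f s0 t0 u0) \<noteq> 0" "eval4 (C k) (f s0 t0 u0) \<noteq> 0"
    using 0 comp[of s0] comp[of t0] comp[of u0] comp[of "f s0 t0 u0"]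
      comp[of "pair_map A (f s0 t0 u0)"] comp[of "pair_map B (f s0 t0 u0)"] comp[of "pair_map C (f s0 t0 u0)"]
    by (auto simp: D_def pair_map_def)
  define S T U where "S z = s0 + z *s (s - s0)" and "T z = t0 + z *s (t - t0)" and "U z = u0 + z *s (u - u0)" for z
  \<comment> \<open>\<open>N z \<noteq> 0\<close> certifies that the composite is defined at
    \<open>z\<close>; \<open>z = 0\<close> is the known triple and \<open>z = 1\<close> the
    arbitrary one.\<close>
  define N where "N z = S z $ l1 * T z $ l2 * U z $ l3 * f (S z) (T z) (U z) $ l4 *
     eval4 (A i) (f (S z) (T z) (U z)) * eval4 (B j) (f (S z) (T z) (U z)) * eval4 (C k) (f (S z) (T z) (U z))" for z
  have pf: "polyfun (\<lambda>z. f (S z) (T z) (U z) $ l)" for l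
    unfolding S_def T_def U_def f_def by (rule polyfun_trilinear_map)
  have pS: "polyfun (\<lambda>z. S z $ l)" "polyfun (\<lambda>z. T z $ l)" "polyfun (\<lambda>z. U z $ l)" for l
    by (simp_all add: S_def T_def U_def) (intro polyfun_intros)+
  have pN: "polyfun N" unfolding N_def by (intro polyfun_intros polyfun_eval4 pf pS)
  have N0: "N 0 \<noteq> 0" using nz by (simp add: N_def S_def T_def U_def)
  have D': "S z \<noteq> 0 \<and> T z \<noteq> 0 \<and> U z \<noteq> 0 \<and> f (S z) (T z) (U z) \<in> D" if "N z \<noteq> 0" for z
    using that by (auto simp: N_def D_def pair_map_def vec_eq_iff)
  define EA where "EA z = S z $ 0 * eval4 (A 1) (f (S z) (T z) (U z)) - S z $ 1 * eval4 (A 0) (f (S z) (T z) (U z))" for z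
  have "EA z * N z = 0" for z
  proof (cases "N z = 0")
    case False
    then have "same_point (S z) (pair_map A (f (S z) (T z) (U z)))"
      using D' D by blast
    from cross[OF this] show ?thesis by (simp add: EA_def)
  qed simp
  moreover have "polyfun EA"
    unfolding EA_def by (intro polyfun_intros polyfun_eval4 pf pS)
  ultimately have "EA 1 = 0"
    using polyfun_mult_eq_0[of EA N 0 1] pN N0 by blast
  then show ?A by (simp add: EA_def S_def T_def U_def)
  define EB where "EB z = T z $ 0 * eval4 (B 1) (f (S z) (T z) (U z)) - T z $ 1 * eval4 (B 0) (f (S z) (T z) (U z))" for z
  have "EB z * N z = 0" for z
  proof (cases "N z = 0")
    case False
    then have "same_point (T z) (pair_map B (f (S z) (T z) (U z)))"
      using D' D by blast
    from cross[OF this] show ?thesis by (simp add: EB_def)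
  qed simp
  moreover have "polyfun EB"
    unfolding EB_def by (intro polyfun_intros polyfun_eval4 pf pS)
  ultimately have "EB 1 = 0"
    using polyfun_mult_eq_0[of EB N 0 1] pN N0 by blast
  then show ?B by (simp add: EB_def S_def T_def U_def)
qed

lemma (in scaled_pyramid) proportional_slices:
  assumes hom: "\<And>i. homogeneous4 1 (F i)"
    and id: "\<And>s t u. s $ 0 * eval4 (F 1) (trilinear_map w P s t u) = s $ 1 * eval4 (F 0) (trilinear_map w P s t u)"
    and nonzero: "\<exists>s t u. pair_map F (trilinear_map w P s t u) \<noteq> 0"
  shows "\<exists>r. \<forall>j k. W 1 j k = r * W 0 j k"
proof -
  have vanish: "eval4 (F (i + 1)) x = 0" if "x \<in> \<Sigma>_surface w P i" for i x
  proof -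
    \<comment> \<open>Setting \<open>s = axis i 1\<close> in the identity isolates
      \<open>F (i + 1)\<close>.\<close>
    have "\<forall>i. eval4 (F (i + 1)) (trilinear_map w P (axis i 1) t u) = 0" for t u
      using id[of "axis 0 1" t u] id[of "axis 1 1" t u] unfolding forall_2_01 by simp
    then show ?thesis using that hom[of "i + 1"] unfolding \<Sigma>_surface_def zariski_closure_def by blast
  qed
  have "\<exists>k. F (i + 1) = lin4 (k *s \<sigma> i)" for i
  proof -
    obtain c where c: "F (i + 1) = lin4 c" using homogeneous4_1_imp_lin4[OF hom] by blast
    have "lf c x = 0" if "lf (\<sigma> i) x = 0" for x
      using vanish[of x i] that by (cases "x = 0") (auto simp: c \<Sigma>_eq)
    then show ?thesis using lf_proportional[of "\<sigma> i" c] c by blast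
  qed
  from this[of 0] this[of 1] obtain k0 k1 where k: "F 0 = lin4 (k0 *s \<sigma> 1)" "F 1 = lin4 (k1 *s \<sigma> 0)"
    by auto
  \<comment> \<open>The vector \<open>1\<close> has both entries 1, so at this \<open>s\<close> and
    coordinate vectors \<open>t\<close>, \<open>u\<close> the identity compares single entries of
    the two slices.\<close>
  have eq: "k1 * of_real (W 1 j k) = k0 * of_real (W 0 j k)" for j k
  proof -
    have "\<forall>j k. (\<Sum>j'\<in>UNIV. \<Sum>k'\<in>UNIV. of_real (W i j' k') * (axis j 1 :: complex^2) $ j' * (axis k 1 :: complex^2) $ k')
       = of_real (W i j k)" for i
      by (simp add: forall_2_01 sum_2_01)
    then have sum: "(\<Sum>j'\<in>UNIV. \<Sum>k'\<in>UNIV. of_real (W i j' k') * (axis j 1 :: complex^2) $ j' * (axis k 1 :: complex^2) $ k')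
       = of_real (W i j k)" for i
      by blast
    show ?thesis
      using id[of 1 "axis j 1" "axis k 1"] lf_\<sigma>_trilinear_map[of 0 1 "axis j 1" "axis k 1"]
        lf_\<sigma>_trilinear_map[of 1 1 "axis j 1" "axis k 1"]
      unfolding sum by (simp add: k)
  qed
  have "k0 \<noteq> 0 \<or> k1 \<noteq> 0"
    using nonzero by (auto simp: k pair_map_def vec_eq_iff forall_2_01)
  moreover obtain j k where jk: "W 0 j k \<noteq> 0" using W_slice_nonzero by blast
  ultimately have "k1 \<noteq> 0" using eq[of j k] by auto
  \<comment> \<open>The ratio \<open>k0 / k1\<close> is a priori complex; a quotient of entries of
    \<open>W\<close> gives it as a real number.\<close>
  have "W 1 j' k' = (W 1 j k / W 0 j k) * W 0 j' k'" for j' k'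
  proof -
    have "complex_of_real (W 1 j' k') = (k0 / k1) * of_real (W 0 j' k')" for j' k'
      using eq[of j' k'] \<open>k1 \<noteq> 0\<close> by (simp add: field_simps)
    from this[of j k] this[of j' k'] jk
    have "complex_of_real (W 1 j' k') = of_real ((W 1 j k / W 0 j k) * W 0 j' k')" by simp
    then show ?thesis by (simp only: of_real_eq_iff)
  qed
  then show ?thesis by blast
qed

lemma (in scaled_pyramid) rank_one_if_inverse_map:
  assumes A: "\<And>i. homogeneous4 1 (F i)" and B: "\<And>i. homogeneous4 1 (G i)"
    and inv: "inverse_map (trilinear_map w P) F G H"
  shows "rank_one W"
proof -
  interpret swapped: scaled_pyramid "swap w" "swap P" A \<tau> \<sigma> v by (rule scaled_swap)
  note id = inverse_map_identities[OF inv]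
  obtain r where r: "W 1 j k = r * W 0 j k" for j k
    using proportional_slices[OF A id(1)] id(3) by blast
  have "swapped.W i j k = W j i k" for i j k by (simp add: W_def swapped.W_def)
  moreover obtain r' where "swapped.W 1 i k = r' * swapped.W 0 i k" for i k
    using swapped.proportional_slices[OF B, unfolded trilinear_map_swap, OF id(2)] id(3) by blast
  ultimately have r': "W i 1 k = r' * W i 0 k" for i k by simp
  \<comment> \<open>The slice relations reduce every entry to some \<open>W 0 0 k\<close>; the first
    two factors record the ratios.\<close>
  define \<alpha> \<beta> \<gamma> :: "real^2" where "\<alpha> = (\<chi> i. if i = 0 then 1 else r)"
    and "\<beta> = (\<chi> j. if j = 0 then 1 else r')" and "\<gamma> = (\<chi> k. W 0 0 k)"
  have "\<forall>i j. W i j k = \<alpha> $ i * \<beta> $ j * \<gamma> $ k" for k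
    by (simp add: forall_2_01 \<alpha>_def \<beta>_def \<gamma>_def r r')
  then have W: "W i j k = \<alpha> $ i * \<beta> $ j * \<gamma> $ k" for i j k by blast
  moreover obtain j k where "W 0 j k \<noteq> 0" using W_slice_nonzero by blast
  ultimately have "\<alpha> \<noteq> 0" "\<beta> \<noteq> 0" "\<gamma> \<noteq> 0" by auto
  with W show ?thesis unfolding rank_one_def by blast
qed

subsection \<open>From the rank one tensor to the inverse map\<close>

lemma homogeneous4_unique_degree:
  assumes "homogeneous4 d F" "homogeneous4 e F" "F \<noteq> 0"
  shows "d = e"
proof -
  obtain m where "m \<in> Poly_Mapping.keys F"
    using \<open>F \<noteq> 0\<close> by (metis lookup_not_eq_zero_eq_in_keys lookup_zero poly_mapping_eqI)
  then show ?thesis using assms by (auto simp: homogeneous4_def)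
qed

text \<open>A common factor of degree \<open>d\<close> divides \<open>G\<close> with constant
  quotient, so it vanishes at \<open>x\<close>, and \<open>F\<close> with it. By
  \<open>irred\<close>, any other common factor is constant.\<close>

lemma no_common_factorI:
  assumes F: "homogeneous4 d F" and G: "homogeneous4 d G" "G \<noteq> 0"
    and x: "eval4 F x \<noteq> 0" "eval4 G x = 0"
    and irred: "\<And>e H K. F = H * K \<Longrightarrow> e \<le> d \<Longrightarrow> homogeneous4 e H \<Longrightarrow> homogeneous4 (d - e) K \<Longrightarrow> e = 0 \<or> e = d"
  shows "no_common_factor F G"
  unfolding no_common_factor_def
proof (intro allI impI)
  fix H assume "H dvd F" "H dvd G"
  then obtain K K' where K: "F = H * K" "G = H * K'" by (metis dvdE)
  have "F \<noteq> 0" using x by auto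
  then obtain e where e: "e \<le> d" "homogeneous4 e H" "homogeneous4 (d - e) K"
    using homogeneous4_factor[of d H K] F by (auto simp: K)
  obtain e' where e': "homogeneous4 e' H" "homogeneous4 (d - e') K'"
    using homogeneous4_factor[of d H K'] G by (auto simp: K)
  have "H \<noteq> 0" using \<open>F \<noteq> 0\<close> K by auto
  then have "e' = e" using homogeneous4_unique_degree e e' by blast
  consider "e = 0" | "e = d" using irred[OF K(1) e] by blast
  then show "H dvd 1"
  proof cases
    case 1
    then obtain c where c: "H = const4 c" using e homogeneous4_0_imp_const4 by blast
    then have "c \<noteq> 0" using \<open>H \<noteq> 0\<close> by (auto simp: const4_def)
    then have "1 = H * const4 (1 / c)" by (intro eval4_inject) (simp add: c)
    then show ?thesis by (rule dvdI)
  next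
    case 2
    then obtain c where c: "K' = const4 c" using e' \<open>e' = e\<close> homogeneous4_0_imp_const4 by auto
    then have "c \<noteq> 0" using \<open>G \<noteq> 0\<close> K by (auto simp: const4_def)
    then show ?thesis using x by (auto simp: K c)
  qed
qed

text \<open>\<open>\<sigma> 0\<close>, \<open>\<sigma> 1\<close>, \<open>\<tau> 0\<close>,
  \<open>\<zeta>\<close> serve as coordinates of the space; \<open>\<tau> 1\<close> follows from the
  two sums equal to \<open>v\<close>.\<close>

locale rank_one_pyramid = scaled_pyramid +
  fixes \<alpha> \<beta> \<gamma> :: "real^2" and \<zeta> :: "complex^4"
  assumes W_eq: "W i j k = \<alpha> $ i * \<beta> $ j * \<gamma> $ k"
    and dual_basis: "lf (\<sigma> 0) x = 0 \<Longrightarrow> lf (\<sigma> 1) x = 0 \<Longrightarrow> lf (\<tau> 0) x = 0 \<Longrightarrow> lf \<zeta> x = 0 \<Longrightarrow> x = 0"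
begin

abbreviation f where "f \<equiv> trilinear_map w P"

lemma \<alpha>_nonzero: "\<alpha> $ i \<noteq> 0" and \<gamma>_nonzero: "\<gamma> $ k \<noteq> 0"
  using W_slice_nonzero[of i] W_slice_nonzero3[of k] by (auto simp: W_eq)

lemma \<beta>_nonzero: "\<beta> $ j \<noteq> 0"
proof -
  interpret swapped: scaled_pyramid "swap w" "swap P" A \<tau> \<sigma> v by (rule scaled_swap)
  have "swapped.W i j k = W j i k" for i j k by (simp add: W_def swapped.W_def)
  then show ?thesis using swapped.W_slice_nonzero[of j] by (auto simp: W_eq)
qed

lemma eqI_dual_basis:
  assumes "lf (\<sigma> 0) x = lf (\<sigma> 0) y" "lf (\<sigma> 1) x = lf (\<sigma> 1) y" "lf (\<tau> 0) x = lf (\<tau> 0) y" "lf \<zeta> x = lf \<zeta> y"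
  shows "x = y"
  using dual_basis[of "x - y"] assms by simp

section \<open>The map in these coordinates\<close>

definition av :: "complex^2 \<Rightarrow> complex" where "av s = of_real (\<alpha> $ 0) * s $ 0 + of_real (\<alpha> $ 1) * s $ 1"
definition bv :: "complex^2 \<Rightarrow> complex" where "bv t = of_real (\<beta> $ 0) * t $ 0 + of_real (\<beta> $ 1) * t $ 1"
definition cv :: "complex^2 \<Rightarrow> complex" where "cv u = of_real (\<gamma> $ 0) * u $ 0 + of_real (\<gamma> $ 1) * u $ 1"

definition z :: "2 \<Rightarrow> 2 \<Rightarrow> 2 \<Rightarrow> complex" where "z i j k = of_real (w i j k) * lf \<zeta> (p i j k)"
definition Z :: "2 \<Rightarrow> complex^2 \<Rightarrow> complex^2 \<Rightarrow> complex" where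
  "Z k s t = (\<Sum>i\<in>UNIV. \<Sum>j\<in>UNIV. z i j k * s $ i * t $ j)"

text \<open>The determinant of \<open>cv\<close> and \<open>lf \<zeta> (f s t u)\<close> as linear
  forms in \<open>u\<close>. Where it vanishes, all \<open>f s t u\<close> are multiples of one
  vector.\<close>

definition D :: "complex^2 \<Rightarrow> complex^2 \<Rightarrow> complex" where
  "D s t = of_real (\<gamma> $ 0) * Z 1 s t - of_real (\<gamma> $ 1) * Z 0 s t"

lemma lf_\<sigma>_f: "lf (\<sigma> (i + 1)) (f s t u) = of_real (\<alpha> $ i) * s $ i * (bv t * cv u)"
  unfolding lf_\<sigma>_trilinear_map by (simp add: W_eq sum_2_01 bv_def cv_def algebra_simps)

lemma lf_\<tau>_f: "lf (\<tau> (j + 1)) (f s t u) = of_real (\<beta> $ j) * t $ j * (av s * cv u)"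
proof -
  interpret swapped: scaled_pyramid "swap w" "swap P" A \<tau> \<sigma> v by (rule scaled_swap)
  have "swapped.W i j k = W j i k" for i j k by (simp add: W_def swapped.W_def)
  then show ?thesis
    using swapped.lf_\<sigma>_trilinear_map[of j t s u] unfolding trilinear_map_swap
    by (simp add: W_eq sum_2_01 av_def cv_def algebra_simps)
qed

lemma lf_v_f: "lf (cvec v) (f s t u) = av s * bv t * cv u"
  using lf_\<sigma>_f[of 0 s t u] lf_\<sigma>_f[of 1 s t u] unfolding sum_\<sigma>[symmetric]
  by (simp add: av_def algebra_simps)

lemma lf_\<zeta>_f: "lf \<zeta> (f s t u) = u $ 0 * Z 0 s t + u $ 1 * Z 1 s t"
  unfolding lf_trilinear_map by (simp add: Z_def z_def sum_2_01 algebra_simps)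

lemma f_scale: "f (a *s s) (b *s t) (c *s u) = (a * b * c) *s f s t u"
  unfolding trilinear_map_def by (simp add: vec_eq_iff sum_distrib_left algebra_simps)

text \<open>If \<open>D\<close> vanished, then \<open>f s t (1, 0)\<close> and \<open>f s t (0, 1)\<close> would be proportional and the two
  quadrics would coincide.\<close>

lemma D_nonzero: "\<exists>s t. D s t \<noteq> 0"
proof (rule ccontr)
  assume "\<not> ?thesis"
  then have D: "D s t = 0" for s t by simp
  define r where "r = complex_of_real (\<gamma> $ 1 / \<gamma> $ 0)"
  have "r \<noteq> 0" using \<gamma>_nonzero by (simp add: r_def)
  have cv: "cv (axis 0 1) = of_real (\<gamma> $ 0)" "cv (axis 1 1) = of_real (\<gamma> $ 1)" by (simp_all add: cv_def)
  have eq: "f s t (axis 1 1) = r *s f s t (axis 0 1)" for s t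
  proof (rule eqI_dual_basis)
    show "lf \<zeta> (f s t (axis 1 1)) = lf \<zeta> (r *s f s t (axis 0 1))"
      using D[of s t] \<gamma>_nonzero[of 0] by (simp add: lf_\<zeta>_f r_def D_def field_simps)
    show "lf (\<sigma> 0) (f s t (axis 1 1)) = lf (\<sigma> 0) (r *s f s t (axis 0 1))"
      using lf_\<sigma>_f[of 1 s t] \<gamma>_nonzero[of 0] by (simp add: r_def cv)
    show "lf (\<sigma> 1) (f s t (axis 1 1)) = lf (\<sigma> 1) (r *s f s t (axis 0 1))"
      using lf_\<sigma>_f[of 0 s t] \<gamma>_nonzero[of 0] by (simp add: r_def cv)
    show "lf (\<tau> 0) (f s t (axis 1 1)) = lf (\<tau> 0) (r *s f s t (axis 0 1))"
      using lf_\<tau>_f[of 1 s t] \<gamma>_nonzero[of 0] by (simp add: r_def cv)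
  qed
  \<comment> \<open>The factor \<open>r\<close> is absorbed into the parameter \<open>s\<close>, so
    the two images agree as sets of vectors.\<close>
  have f1: "f s t (axis 1 1) = f (r *s s) t (axis 0 1)" and f0: "f s t (axis 0 1) = f ((1 / r) *s s) t (axis 1 1)" for s t
    using eq f_scale[of r s 1 t 1 "axis 0 1"] f_scale[of "1 / r" s 1 t 1 "axis 1 1"] \<open>r \<noteq> 0\<close> by simp_all
  have nz: "r *s s \<noteq> 0" "(1 / r) *s s \<noteq> 0" if "s \<noteq> 0" for s :: "complex^2"
    using that \<open>r \<noteq> 0\<close> by simp_all
  have "(\<exists>s t. s \<noteq> 0 \<and> t \<noteq> 0 \<and> x = f s t (axis 0 1)) \<longleftrightarrow> (\<exists>s t. s \<noteq> 0 \<and> t \<noteq> 0 \<and> x = f s t (axis 1 1))" for x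
    using f0 f1 nz by blast
  then have "Y_surface w P 0 = Y_surface w P 1"
    unfolding Y_surface_def by simp
  then show False using Y_neq by blast
qed

text \<open>Both parameters move in the direction \<open>(1, 0)\<close> from a point where
  \<open>D\<close> is nonzero. If the product always vanished, \<open>D\<close> and then
  \<open>bv\<close> could be cancelled, leaving \<open>av\<close> identically zero against
  \<open>\<alpha> $ 0 \<noteq> 0\<close>.\<close>

lemma generic_point: "\<exists>s t. D s t \<noteq> 0 \<and> av s \<noteq> 0 \<and> bv t \<noteq> 0"
proof (rule ccontr)
  assume none: "\<not> ?thesis"
  obtain s t where st: "D s t \<noteq> 0" using D_nonzero by blast
  define S T where "S x = s + x *s axis 0 1" and "T x = t + x *s axis 0 1" for x :: complex
  have av: "av (S x) = av s + x * of_real (\<alpha> $ 0)" and bv: "bv (T x) = bv t + x * of_real (\<beta> $ 0)" for x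
    by (simp_all add: av_def bv_def S_def T_def algebra_simps)
  have pS: "polyfun (\<lambda>x. S x $ l)" "polyfun (\<lambda>x. T x $ l)" for l
    unfolding S_def T_def by (simp_all, (intro polyfun_intros)+)
  have pf: "polyfun (\<lambda>x. D (S x) (T x))" "polyfun (\<lambda>x. av (S x))" "polyfun (\<lambda>x. bv (T x))"
    unfolding D_def Z_def av_def bv_def by (intro polyfun_intros pS)+
  have "D (S 0) (T 0) \<noteq> 0" using st by (simp add: S_def T_def)
  moreover have "(av (S x) * bv (T x)) * D (S x) (T x) = 0" for x using none by auto
  ultimately have ab: "av (S x) * bv (T x) = 0" for x
    using polyfun_mult_eq_0[of "\<lambda>x. av (S x) * bv (T x)" "\<lambda>x. D (S x) (T x)" 0 x, OF polyfun_mult] pf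
    by blast
  have "bv (T x) \<noteq> 0" if "x \<noteq> - bv t / of_real (\<beta> $ 0)" for x
    using that \<beta>_nonzero[of 0] by (simp add: bv field_simps add_eq_0_iff)
  then have "bv (T (1 - bv t / of_real (\<beta> $ 0))) \<noteq> 0" by simp
  then have "av (S x) = 0" for x
    using polyfun_mult_eq_0[of "\<lambda>x. av (S x)" "\<lambda>x. bv (T x)"] pf ab by blast
  from this[of 0] this[of 1] show False using \<alpha>_nonzero[of 0] by (simp add: av)
qed

text \<open>\<open>F, G, H\<close> are the pairs \<open>A, B, C\<close> of the inverse. If \<open>x = f s t u\<close>, then
  \<open>lf \<zeta> x / lf v x = (\<Sum>k. u\<^sub>k Z\<^sub>k(s, t)) / (av s bv t cv u)\<close>; inserting \<open>s = F x\<close> and \<open>t = G x\<close> and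
  clearing denominators turns this into \<open>u\<^sub>0 Q\<^sub>0(x) + u\<^sub>1 Q\<^sub>1(x) = 0\<close>.\<close>

definition F :: "2 \<Rightarrow> poly4" where "F i = lin4 (of_real (\<alpha> $ (i + 1)) *s \<sigma> (i + 1))"
definition G :: "2 \<Rightarrow> poly4" where "G j = lin4 (of_real (\<beta> $ (j + 1)) *s \<tau> (j + 1))"

definition q :: "2 \<Rightarrow> complex^4 \<Rightarrow> complex" where
  "q k x = (\<Sum>i\<in>UNIV. \<Sum>j\<in>UNIV. z i j k / (of_real (\<alpha> $ i) * of_real (\<beta> $ j)) * lf (\<sigma> (i + 1)) x * lf (\<tau> (j + 1)) x)"

definition Q :: "2 \<Rightarrow> poly4" where
  "Q k = const4 (of_real (\<gamma> $ k)) * (lin4 (cvec v) * lin4 \<zeta>) -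
     (\<Sum>i\<in>UNIV. \<Sum>j\<in>UNIV. const4 (z i j k / (of_real (\<alpha> $ i) * of_real (\<beta> $ j))) * (lin4 (\<sigma> (i + 1)) * lin4 (\<tau> (j + 1))))"

definition H :: "2 \<Rightarrow> poly4" where "H k = (if k = 0 then - Q 1 else Q 0)"

section \<open>Degrees and composites of the inverse\<close>

lemma eval4_Q: "eval4 (Q k) x = of_real (\<gamma> $ k) * lf (cvec v) x * lf \<zeta> x - q k x"
  by (simp add: Q_def q_def mult.assoc)

lemma homogeneous4_Q: "homogeneous4 2 (Q k)"
proof -
  have *: "homogeneous4 2 (const4 c * (lin4 a * lin4 b))" for a b c
    using homogeneous4_mult[OF homogeneous4_const4 homogeneous4_mult[OF homogeneous4_lin4 homogeneous4_lin4]]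
    by (simp add: numeral_2_eq_2)
  show ?thesis unfolding Q_def by (intro homogeneous4_diff homogeneous4_sum *)
qed

lemma homogeneous4_H: "homogeneous4 2 (H k)"
  by (simp add: H_def homogeneous4_Q homogeneous4_uminus)

text \<open>The factor \<open>\<alpha> $ (i + 1)\<close> in \<open>F i\<close> completes the
  \<open>\<alpha> $ i\<close> produced by \<open>f\<close> to a scalar independent of
  \<open>i\<close>.\<close>

lemma pair_map_F_f: "pair_map F (f s t u) = (of_real (\<alpha> $ 0 * \<alpha> $ 1) * (bv t * cv u)) *s s"
  using lf_\<sigma>_f[of 0 s t u] lf_\<sigma>_f[of 1 s t u]
  by (simp add: pair_map_def F_def vec2_eq_iff algebra_simps)

lemma pair_map_G_f: "pair_map G (f s t u) = (of_real (\<beta> $ 0 * \<beta> $ 1) * (av s * cv u)) *s t"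
  using lf_\<tau>_f[of 0 s t u] lf_\<tau>_f[of 1 s t u]
  by (simp add: pair_map_def G_def vec2_eq_iff algebra_simps)

lemma eval4_Q_f:
  "eval4 (Q k) (f s t u) = av s * bv t * cv u * (of_real (\<gamma> $ k) * lf \<zeta> (f s t u) - cv u * Z k s t)"
proof -
  have "q k (f s t u) = (\<Sum>i\<in>UNIV. \<Sum>j\<in>UNIV. z i j k * s $ i * t $ j * (av s * bv t * cv u * cv u))"
    unfolding q_def lf_\<sigma>_f lf_\<tau>_f using \<alpha>_nonzero \<beta>_nonzero by (intro sum.cong refl) (simp add: field_simps)
  also have "\<dots> = Z k s t * (av s * bv t * cv u * cv u)"
    unfolding Z_def by (simp only: sum_distrib_right)
  finally show ?thesis by (simp add: eval4_Q lf_v_f algebra_simps)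
qed

text \<open>Expanded in \<open>u\<close>, the last factor in \<open>eval4_Q_f\<close> is
  \<open>u $ 1 * D s t\<close> for \<open>Q 0\<close> and \<open>- u $ 0 * D s t\<close> for
  \<open>Q 1\<close>; order and sign in \<open>H\<close> undo this.\<close>

lemma pair_map_H_f: "pair_map H (f s t u) = (av s * bv t * cv u * D s t) *s u"
  by (simp add: pair_map_def H_def vec2_eq_iff eval4_Q_f lf_\<zeta>_f D_def cv_def algebra_simps)

lemma f_pair_maps:
  "f (pair_map F x) (pair_map G x) (pair_map H x) =
     (of_real (\<alpha> $ 0 * \<alpha> $ 1 * \<beta> $ 0 * \<beta> $ 1) * lf (cvec v) x * cv (pair_map H x)) *s x"
proof -
  let ?s = "pair_map F x" and ?t = "pair_map G x" and ?u = "pair_map H x"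
  let ?a = "complex_of_real (\<alpha> $ 0 * \<alpha> $ 1)" and ?b = "complex_of_real (\<beta> $ 0 * \<beta> $ 1)" and ?h = "lf (cvec v) x"
  have \<alpha>2: "complex_of_real (\<alpha> $ i) * of_real (\<alpha> $ (i + 1)) = ?a"
    and \<beta>2: "complex_of_real (\<beta> $ i) * of_real (\<beta> $ (i + 1)) = ?b" for i
    using cases_2_Suc[of i 0] by auto
  have s: "?s $ i = of_real (\<alpha> $ (i + 1)) * lf (\<sigma> (i + 1)) x" and t: "?t $ i = of_real (\<beta> $ (i + 1)) * lf (\<tau> (i + 1)) x" for i
    by (simp_all add: pair_map_def F_def G_def)
  have av: "av ?s = ?a * ?h" unfolding sum_\<sigma>[symmetric] by (simp add: av_def s algebra_simps)
  have bv: "bv ?t = ?b * ?h" unfolding sum_\<tau>[symmetric] by (simp add: bv_def t algebra_simps)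
  have Z: "Z k ?s ?t = ?a * ?b * q k x" for k
  proof -
    have "z i j k * ?s $ i * ?t $ j =
       ?a * ?b * (z i j k / (of_real (\<alpha> $ i) * of_real (\<beta> $ j)) * lf (\<sigma> (i + 1)) x * lf (\<tau> (j + 1)) x)" for i j
      unfolding \<alpha>2[of i, symmetric] \<beta>2[of j, symmetric] s t using \<alpha>_nonzero[of i] \<beta>_nonzero[of j] by (simp add: field_simps)
    then show ?thesis unfolding Z_def q_def by (simp only: sum_distrib_left)
  qed
  have u: "?u $ 0 = - eval4 (Q 1) x" "?u $ 1 = eval4 (Q 0) x" by (simp_all add: pair_map_def H_def)
  \<comment> \<open>The terms of \<open>Q 0\<close> and \<open>Q 1\<close> that contain
    \<open>lf \<zeta> x\<close> cancel in this combination.\<close>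
  have cv: "cv ?u = of_real (\<gamma> $ 0) * q 1 x - of_real (\<gamma> $ 1) * q 0 x"
    unfolding cv_def u eval4_Q by (simp add: algebra_simps)
  show ?thesis
  proof (rule eqI_dual_basis)
    \<comment> \<open>Here the products \<open>q 0 x * q 1 x\<close> cancel, and what remains has
      the factor \<open>lf \<zeta> x\<close>.\<close>
    show "lf \<zeta> (f ?s ?t ?u) = lf \<zeta> ((of_real (\<alpha> $ 0 * \<alpha> $ 1 * \<beta> $ 0 * \<beta> $ 1) * ?h * cv ?u) *s x)"
      unfolding lf_\<zeta>_f Z u eval4_Q lf_scale_right cv by (simp add: algebra_simps)
    show "lf (\<sigma> 0) (f ?s ?t ?u) = lf (\<sigma> 0) ((of_real (\<alpha> $ 0 * \<alpha> $ 1 * \<beta> $ 0 * \<beta> $ 1) * ?h * cv ?u) *s x)"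
      using lf_\<sigma>_f[of 1 ?s ?t ?u] s[of 1] by (simp add: bv algebra_simps)
    show "lf (\<sigma> 1) (f ?s ?t ?u) = lf (\<sigma> 1) ((of_real (\<alpha> $ 0 * \<alpha> $ 1 * \<beta> $ 0 * \<beta> $ 1) * ?h * cv ?u) *s x)"
      using lf_\<sigma>_f[of 0 ?s ?t ?u] s[of 0] by (simp add: bv algebra_simps)
    show "lf (\<tau> 0) (f ?s ?t ?u) = lf (\<tau> 0) ((of_real (\<alpha> $ 0 * \<alpha> $ 1 * \<beta> $ 0 * \<beta> $ 1) * ?h * cv ?u) *s x)"
      using lf_\<tau>_f[of 1 ?s ?t ?u] t[of 1] by (simp add: av algebra_simps)
  qed
qed

text \<open>Both composites multiply by scalars, so only definedness somewhere remains; a generic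
  \<open>(s, t)\<close> with \<open>u = (1, 0)\<close> provides it, as
  \<open>\<gamma> $ 0 \<noteq> 0\<close>.\<close>

lemma inverse_map_FGH: "inverse_map f F G H"
proof -
  obtain s t where st: "D s t \<noteq> 0" "av s \<noteq> 0" "bv t \<noteq> 0" using generic_point by blast
  let ?u = "axis 0 1 :: complex^2"
  have "cv ?u \<noteq> 0" using \<gamma>_nonzero[of 0] by (simp add: cv_def)
  have nz: "s \<noteq> 0" "t \<noteq> 0" "?u \<noteq> 0" using st by (auto simp: av_def bv_def axis_eq_0_iff)
  let ?x = "f s t ?u"
  have x: "pair_map F ?x \<noteq> 0" "pair_map G ?x \<noteq> 0" "pair_map H ?x \<noteq> 0"
    unfolding pair_map_F_f pair_map_G_f pair_map_H_f
    using st nz \<open>cv ?u \<noteq> 0\<close> \<alpha>_nonzero \<beta>_nonzero by simp_all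
  have "?x \<noteq> 0" using lf_v_f[of s t ?u] st \<open>cv ?u \<noteq> 0\<close> by auto
  have fx: "f (pair_map F ?x) (pair_map G ?x) (pair_map H ?x) \<noteq> 0"
    unfolding pair_map_F_f pair_map_G_f pair_map_H_f f_scale
    using st \<open>cv ?u \<noteq> 0\<close> \<alpha>_nonzero \<beta>_nonzero \<open>?x \<noteq> 0\<close> by simp
  have same: "same_point y (c *s y)" if "y \<noteq> 0" "c *s y \<noteq> 0" for c and y :: "complex^'n"
    using that by (auto simp: same_point_def)
  define dom where "dom = {x. x \<noteq> 0 \<and> pair_map F x \<noteq> 0 \<and> pair_map G x \<noteq> 0 \<and> pair_map H x \<noteq> 0}"
  have dom_x: "?x \<in> dom" using x \<open>?x \<noteq> 0\<close> by (simp add: dom_def)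
  have "same_point s (pair_map F (f s t u)) \<and> same_point t (pair_map G (f s t u)) \<and> same_point u (pair_map H (f s t u))"
    if "s \<noteq> 0" "t \<noteq> 0" "u \<noteq> 0" "f s t u \<in> dom" for s t u
    using that unfolding dom_def mem_Collect_eq pair_map_F_f pair_map_G_f pair_map_H_f by (blast intro: same)
  moreover have "same_point x (f (pair_map F x) (pair_map G x) (pair_map H x))"
    if "x \<in> dom" "f (pair_map F x) (pair_map G x) (pair_map H x) \<noteq> 0" for x
    using that unfolding dom_def mem_Collect_eq f_pair_maps by (blast intro: same)
  moreover have "(s, t, ?u) \<in> {(s, t, u). s \<noteq> 0 \<and> t \<noteq> 0 \<and> u \<noteq> 0 \<and> f s t u \<in> dom}"
    using nz dom_x by simp
  moreover have "?x \<in> {x \<in> dom. f (pair_map F x) (pair_map G x) (pair_map H x) \<noteq> 0}"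
    using fx dom_x by simp
  ultimately show ?thesis
    unfolding inverse_map_def Let_def dom_def[symmetric]
    by (intro conjI ballI) (blast, force, blast, blast)
qed

text \<open>\<open>Q k\<close> vanishes on the quadric \<open>Y\<^sub>k\<close>, so it cannot have a linear factor.\<close>

lemma Q_no_linear_factor:
  assumes "Q k = lin4 c * lin4 c'"
  shows "Q k = 0"
proof -
  let ?u = "axis k 1 :: complex^2"
  \<comment> \<open>Thus both terms of the last factor in \<open>eval4_Q_f\<close> equal
    \<open>\<gamma> $ k * Z k s t\<close>.\<close>
  have k: "\<forall>k. cv (axis k 1) = of_real (\<gamma> $ k) \<and> lf \<zeta> (f s t (axis k 1)) = Z k s t" for s t
    by (simp add: forall_2_01 cv_def lf_\<zeta>_f)
  have "eval4 (Q k) (f s t ?u) = 0" for s t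
    unfolding eval4_Q_f using k[of s t] by simp
  then have prod: "lf c (f s t ?u) * lf c' (f s t ?u) = 0" for s t
    unfolding assms by simp
  have plane: "d = 0" if "\<And>s t. lf d (f s t ?u) = 0" for d
  proof (rule quadric_not_in_plane[OF quadric_Y[of k]])
    show "Y_surface w P k \<subseteq> {x. lf d x = 0}"
      unfolding Y_surface_def by (intro zariski_closure_subset_plane) (use that in auto)
  qed
  show ?thesis
  proof (cases "\<forall>s t. lf c' (f s t ?u) = 0")
    case True
    then have "c' = 0" using plane by blast
    then show ?thesis unfolding assms by (intro eval4_eq_zeroD) simp
  next
    case False
    then obtain s0 t0 where 0: "lf c' (f s0 t0 ?u) \<noteq> 0" by blast
    have "lf c (f s t ?u) = 0" for s t
    proof -
      \<comment> \<open>On the line from \<open>(s0, t0)\<close> to \<open>(s, t)\<close>, with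
        \<open>u\<close> fixed, the product is zero while \<open>lf c'\<close> starts nonzero, so
        \<open>lf c\<close> vanishes.\<close>
      define g where "g x = f (s0 + x *s (s - s0)) (t0 + x *s (t - t0)) (?u + x *s 0)" for x
      have pf: "polyfun (\<lambda>x. lf d (g x))" for d
        unfolding lf_def g_def by (intro polyfun_intros polyfun_trilinear_map)
      have "lf c (g 1) = 0"
        using polyfun_mult_eq_0[OF pf pf, of c c' 0 1] prod 0 by (simp add: g_def)
      then show ?thesis by (simp add: g_def)
    qed
    then have "c = 0" using plane by blast
    then show ?thesis unfolding assms by (intro eval4_eq_zeroD) simp
  qed
qed

text \<open>The linear pairs are coprime since at some point exactly one member vanishes. For the
  quadratic pair, a proper factorization of \<open>H 0\<close> would split \<open>Q 1\<close> into
  linear forms.\<close>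

lemma birational_of_type_112: "birational_of_type f (1, 1, 2)"
proof -
  obtain s t where st: "D s t \<noteq> 0" "av s \<noteq> 0" "bv t \<noteq> 0" using generic_point by blast
  have nz: "av (axis i 1) \<noteq> 0" "bv (axis i 1) \<noteq> 0" "cv (axis i 1) \<noteq> 0" for i
  proof -
    have "\<forall>i. av (axis i 1) = of_real (\<alpha> $ i) \<and> bv (axis i 1) = of_real (\<beta> $ i) \<and> cv (axis i 1) = of_real (\<gamma> $ i)"
      by (simp add: forall_2_01 av_def bv_def cv_def)
    then show "av (axis i 1) \<noteq> 0" "bv (axis i 1) \<noteq> 0" "cv (axis i 1) \<noteq> 0"
      using \<alpha>_nonzero \<beta>_nonzero \<gamma>_nonzero by simp_all
  qed
  have "no_common_factor (F 0) (F 1)"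
  proof (rule no_common_factorI[of 1])
    let ?x = "\<lambda>i. f (axis i 1) t (axis 0 1)"
    have ev: "eval4 (F j) (?x i) = of_real (\<alpha> $ 0 * \<alpha> $ 1) * (bv t * cv (axis 0 1)) * axis i 1 $ j" for i j
      using pair_map_F_f[of "axis i 1" t "axis 0 1"] by (simp add: pair_map_def vec_eq_iff)
    show "eval4 (F 0) (?x 0) \<noteq> 0" "eval4 (F 1) (?x 0) = 0"
      using st nz \<alpha>_nonzero by (simp_all add: ev)
    have "eval4 (F 1) (?x 1) \<noteq> 0" using st nz \<alpha>_nonzero by (simp add: ev)
    then show "F 1 \<noteq> 0" by auto
  qed (auto simp: F_def homogeneous4_lin4[simplified])
  moreover have "no_common_factor (G 0) (G 1)"
  proof (rule no_common_factorI[of 1])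
    let ?x = "\<lambda>i. f s (axis i 1) (axis 0 1)"
    have ev: "eval4 (G j) (?x i) = of_real (\<beta> $ 0 * \<beta> $ 1) * (av s * cv (axis 0 1)) * axis i 1 $ j" for i j
      using pair_map_G_f[of s "axis i 1" "axis 0 1"] by (simp add: pair_map_def vec_eq_iff)
    show "eval4 (G 0) (?x 0) \<noteq> 0" "eval4 (G 1) (?x 0) = 0"
      using st nz \<beta>_nonzero by (simp_all add: ev)
    have "eval4 (G 1) (?x 1) \<noteq> 0" using st nz \<beta>_nonzero by (simp add: ev)
    then show "G 1 \<noteq> 0" by auto
  qed (auto simp: G_def homogeneous4_lin4[simplified])
  moreover have "no_common_factor (H 0) (H 1)"
  proof (rule no_common_factorI[of 2])
    let ?x = "\<lambda>k. f s t (axis k 1)"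
    have ev: "eval4 (H j) (?x k) = (av s * bv t * cv (axis k 1) * D s t) * axis k 1 $ j" for j k
      using pair_map_H_f[of s t "axis k 1"] by (simp add: pair_map_def vec_eq_iff)
    show H0: "eval4 (H 0) (?x 0) \<noteq> 0" "eval4 (H 1) (?x 0) = 0"
      using st nz by (simp_all add: ev)
    have "eval4 (H 1) (?x 1) \<noteq> 0" using st nz by (simp add: ev)
    then show "H 1 \<noteq> 0" by auto
    fix e K L
    assume KL: "H 0 = K * L" "e \<le> 2" "homogeneous4 e K" "homogeneous4 (2 - e) L"
    show "e = 0 \<or> e = 2"
    proof (rule ccontr)
      assume "\<not> ?thesis"
      then have "e = 1" using KL by auto
      then obtain c c' where "K = lin4 c" "L = lin4 c'"
        using KL homogeneous4_1_imp_lin4[of K] homogeneous4_1_imp_lin4[of L] by auto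
      then have "H 0 = lin4 c * lin4 c'" using KL by simp
      then have "Q 1 = lin4 (- c) * lin4 c'"
        by (intro eval4_inject) (simp add: H_def, metis add.inverse_inverse eval4_lin4 eval4_mult eval4_uminus lf_0_left lf_diff_left minus_mult_left diff_0)
      then have "Q 1 = 0" by (rule Q_no_linear_factor)
      then show False using H0 by (simp add: H_def)
    qed
  qed (rule homogeneous4_H)+
  moreover have "homogeneous4 1 (F i)" "homogeneous4 1 (G i)" for i
    unfolding F_def G_def by (rule homogeneous4_lin4)+
  ultimately show ?thesis
    unfolding birational_of_type_def prod.case
    by (intro exI[of _ F] exI[of _ G] exI[of _ H] conjI allI homogeneous4_H inverse_map_FGH)
qed

end

lemma (in scaled_pyramid) birational_if_rank_one:
  assumes "rank_one W"
  shows "birational_of_type (trilinear_map w P) (1, 1, 2)"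
proof -
  obtain \<alpha> \<beta> \<gamma> :: "real^2" where W: "\<And>i j k. W i j k = \<alpha> $ i * \<beta> $ j * \<gamma> $ k"
    using assms by (auto simp: rank_one_def)
  \<comment> \<open>\<open>\<tau> 0\<close> lies outside the pencil of \<open>\<sigma> 0\<close> and
    \<open>\<sigma> 1\<close> by the swapped \<open>\<sigma>_not_in_pencil\<close>; these two are
    told apart by a control point where only \<open>\<sigma> 0\<close> vanishes.\<close>
  have indep: "x = 0 \<and> y = 0 \<and> z = 0" if eq: "x *s \<sigma> 0 + y *s \<sigma> 1 + z *s \<tau> 0 = 0" for x y z
  proof -
    interpret swapped: scaled_pyramid "swap w" "swap P" A \<tau> \<sigma> v by (rule scaled_swap)
    have "z = 0"
    proof (rule ccontr)
      assume "z \<noteq> 0"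
      have "z *s \<tau> 0 = (- x) *s \<sigma> 0 + (- y) *s \<sigma> 1"
        using eq by (simp add: vec_eq_iff algebra_simps eq_neg_iff_add_eq_0)
      then have "(1 / z) *s (z *s \<tau> 0) = (- x / z) *s \<sigma> 0 + (- y / z) *s \<sigma> 1"
        by (simp add: vector_add_ldistrib)
      then have "\<tau> 0 = (- x / z) *s \<sigma> 0 + (- y / z) *s \<sigma> 1" using \<open>z \<noteq> 0\<close> by simp
      then show False using swapped.\<sigma>_not_in_pencil by blast
    qed
    obtain j k where "W 0 j k \<noteq> 0" using W_slice_nonzero by blast
    then have "lf (\<sigma> 1) (p 0 j k) \<noteq> 0" using lf_\<sigma>_p[of 0 0 j k] by (auto simp: W_def)
    moreover have "lf (x *s \<sigma> 0 + y *s \<sigma> 1) (p 0 j k) = 0" using eq \<open>z = 0\<close> by simp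
    ultimately have "y = 0" by (simp add: \<sigma>_vanish)
    then have "x *s \<sigma> 0 = 0" using eq \<open>z = 0\<close> by simp
    then show ?thesis using \<open>z = 0\<close> \<open>y = 0\<close> \<sigma>_nonzero[of 0] by simp
  qed
  obtain \<zeta> where \<zeta>: "\<And>x. lf (\<sigma> 0) x = 0 \<Longrightarrow> lf (\<sigma> 1) x = 0 \<Longrightarrow> lf (\<tau> 0) x = 0 \<Longrightarrow> lf \<zeta> x = 0 \<Longrightarrow> x = 0"
    using extend_to_dual_basis[OF indep] by blast
  interpret rank_one_pyramid w P A \<sigma> \<tau> v \<alpha> \<beta> \<gamma> \<zeta>
    by unfold_locales (fact W, fact \<zeta>)
  show ?thesis by (rule birational_of_type_112)
qed

theorem theorem4p6:
  fixes w :: "2 \<Rightarrow> 2 \<Rightarrow> 2 \<Rightarrow> real"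
    and P :: "2 \<Rightarrow> 2 \<Rightarrow> 2 \<Rightarrow> real^4"
    and \<pi>\<^sub>0 :: "real^4"
  assumes control_points: "\<And>i j k. P i j k $ 0 = 1"
    and nondegenerate: "nondegenerate w P"
    and pyramidal: "pyramidal_u w P"
    and \<pi>\<^sub>0_nonzero: "\<pi>\<^sub>0 \<noteq> 0"
    and plane_through_s: "\<Sigma>_surface w P 0 \<inter> \<Sigma>_surface w P 1 \<subseteq> real_plane \<pi>\<^sub>0"
    and plane_through_t: "T_surface w P 0 \<inter> T_surface w P 1 \<subseteq> real_plane \<pi>\<^sub>0"
  shows "birational_of_type (trilinear_map w P) (1, 1, 2) \<longleftrightarrow>
         rank_one (\<lambda>i j k. w i j k / \<Delta> \<pi>\<^sub>0 P i j k)"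
proof -
  obtain A where A: "\<And>i j. A \<in> u_line P i j" and quadric: "\<And>k. quadric (Y_surface w P k)"
    using pyramidal by (auto simp: pyramidal_u_def)
  note nd = nondegenerate[unfolded nondegenerate_def Let_def]
  have "\<forall>i. smooth_surface (\<Sigma>_surface w P i)" "\<forall>j. smooth_surface (T_surface w P j)"
    "Y_surface w P 0 \<noteq> Y_surface w P 1" "\<forall>i j. \<Sigma>_surface w P i \<noteq> T_surface w P j"
    "\<forall>i j. is_line (u_line P i j)" "\<forall>i. u_line P i 0 \<noteq> u_line P i 1" "\<forall>j. u_line P 0 j \<noteq> u_line P 1 j"
    using nd unfolding forall_2_01 by simp_all
  with A quadric interpret pyramid w P A
    by unfold_locales blast+
  have "\<exists>\<sigma>. \<forall>i. (\<forall>j k. lf (\<sigma> i) (p i j k) = 0) \<and> \<sigma> i \<noteq> 0 \<and> \<Sigma>_surface w P i = {x. x \<noteq> 0 \<and> lf (\<sigma> i) x = 0}"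
    using \<Sigma>_plane_exists by (intro choice) blast
  then obtain \<sigma> where \<sigma>: "\<And>i j k. lf (\<sigma> i) (p i j k) = 0" "\<And>i. \<sigma> i \<noteq> 0"
    "\<And>i. \<Sigma>_surface w P i = {x. x \<noteq> 0 \<and> lf (\<sigma> i) x = 0}" by blast
  have "\<exists>\<tau>. \<forall>j. (\<forall>i k. lf (\<tau> j) (p i j k) = 0) \<and> \<tau> j \<noteq> 0 \<and> T_surface w P j = {x. x \<noteq> 0 \<and> lf (\<tau> j) x = 0}"
    using T_plane_exists by (intro choice) blast
  then obtain \<tau> where \<tau>: "\<And>i j k. lf (\<tau> j) (p i j k) = 0" "\<And>j. \<tau> j \<noteq> 0"
    "\<And>j. T_surface w P j = {x. x \<noteq> 0 \<and> lf (\<tau> j) x = 0}" by blast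
  interpret pyramid_planes w P A \<sigma> \<tau>
    by unfold_locales (use \<sigma> \<tau> in blast)+
  obtain \<sigma>' \<tau>' where "scaled_pyramid w P A \<sigma>' \<tau>' \<pi>\<^sub>0"
    using scaled_pyramid_exists[OF \<pi>\<^sub>0_nonzero plane_through_s plane_through_t] by blast
  then interpret scaled: scaled_pyramid w P A \<sigma>' \<tau>' \<pi>\<^sub>0 .
  \<comment> \<open>Dividing by \<open>1 / x\<close> is multiplying by \<open>x\<close>, also for
    \<open>x = 0\<close>, where both results are 0.\<close>
  have "(\<lambda>i j k. w i j k / \<Delta> \<pi>\<^sub>0 P i j k) = scaled.W"
    by (simp add: fun_eq_iff \<Delta>_def scaled.W_def)
  moreover have "rank_one scaled.W" if "birational_of_type (trilinear_map w P) (1, 1, 2)"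
    using that unfolding birational_of_type_def prod.case
    by (blast intro: scaled.rank_one_if_inverse_map)
  ultimately show ?thesis using scaled.birational_if_rank_one by metis
qed

end
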